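(* Let $\{f(x)\}_{x\ge 0}$ be a real-valued Gauss-Markov process with mean function $m$, covariance function $C$ and variance function $V$. Let $n\ge 1$, let $0\le x_1\le x_2\le\dots\le x_n$ be sampling points, and let $y_i=f(x_i)+\varepsilon_i$ for $i=1,\dots,n$, where the errors $(\varepsilon_1,\dots,\varepsilon_n)$ are jointly Gaussian (with arbitrary variances and covariances), have mean $E[\varepsilon_i]=0$ for each $i$, and are independent of $\{f(x)\}_{x\ge 0}$. Let $\mathcal{D}=\{(x_i,y_i)\}_{i=1}^n$. Then for every $x\ge 0$ the conditional distribution of $f(x)$ given $\mathcal{D}$ is Gaussian. Moreover: (i) If $x\le x_1$ and $V(x_1)\neq 0$, then $$E[f(x)\mid\mathcal{D}]=m(x)+\frac{C(x_1,x)}{V(x_1)}\bigl(E[f(x_1)\mid\mathcal{D}]-m(x_1)\bigr)$$ and $$\mathrm{Var}(f(x)\mid\mathcal{D})=\left(\frac{C(x_1,x)}{V(x_1)}\right)^2\mathrm{Var}(f(x_1)\mid\mathcal{D})+\mathrm{Var}(f(x)\mid f(x_1)).$$ (ii) If $x_k\le x\le x_{k+1}$ for some $k<n$ with $V(x_k)V(x_{k+1})-C(x_k,x_{k+1})^2\neq 0$, then $$E[f(x)\mid\mathcal{D}]=m(x)+w(x,x_k,x_{k+1})^T\begin{bmatrix}E[f(x_k)\mid\mathcal{D}]-m(x_k)\\ E[f(x_{k+1})\mid\mathcal{D}]-m(x_{k+1})\end{bmatrix}$$ and $$\mathrm{Var}(f(x)\mid\mathcal{D})=w(x,x_k,x_{k+1})^T\,\mathrm{Var}\left(\begin{bmatrix}f(x_k)\\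 f(x_{k+1})\end{bmatrix}\,\middle|\,\mathcal{D}\right)w(x,x_k,x_{k+1})+\mathrm{Var}\bigl(f(x)\mid f(x_k),f(x_{k+1})\bigr).$$ (iii) If $x\ge x_n$ and $V(x_n)\neq 0$, then $$E[f(x)\mid\mathcal{D}]=m(x)+\frac{C(x_n,x)}{V(x_n)}\bigl(E[f(x_n)\mid\mathcal{D}]-m(x_n)\bigr)$$ and $$\mathrm{Var}(f(x)\mid\mathcal{D})=\left(\frac{C(x_n,x)}{V(x_n)}\right)^2\mathrm{Var}(f(x_n)\mid\mathcal{D})+\mathrm{Var}(f(x)\mid f(x_n)).$$
   Context: A Gauss-Markov process $\{f(x)\}_{x\ge 0}$ is a real-valued process such that: (G) for every finite $X\subset[0,\infty)$ the vector $(f(x))_{x\in X}$ is multivariate Gaussian (possibly degenerate); (M) if $x<x'<x''$, then $f(x)$ and $f(x'')$ are conditionally independent given $f(x')$. Its mean, covariance and variance functions are $m(x)=E[f(x)]$, $C(x,x')=\mathrm{Cov}(f(x),f(x'))$ and $V(x)=C(x,x)$ for $x,x'\ge0$. For $x,x',x''\ge 0$ with $V(x')V(x'')-C(x',x'')^2\ne 0$, define the vector $$w(x,x',x'')=\frac{1}{V(x')V(x'')-C(x',x'')^2}\begin{bmatrix}C(x,x')V(x'')-C(x,x'')C(x',x'')\\ C(x,x'')V(x')-C(x,x')C(x',x'')\end{bmatrix}\in\mathbb{R}^2.$$ Conditioning on $\mathcal{D}$ means conditioning on $(y_1,\dots,y_n)$, the points $x_i$ being fixed. $\mathrm{Var}(\cdot\mid\cdot)$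 denotes conditional variance (for a vector, the conditional $2\times 2$ covariance matrix); equalities hold almost surely. "Gaussian" allows degenerate (zero-variance) distributions. *)

theory Defs
  imports "HOL-Probability.Probability"
begin

definition gaussian_measure :: "real measure \<Rightarrow> bool" where
  "gaussian_measure \<mu> \<longleftrightarrow>
     (\<exists>a. \<mu> = return borel a) \<or>
     (\<exists>a \<sigma>. \<sigma> > 0 \<and> \<mu> = density lborel (\<lambda>t. ennreal (normal_density a \<sigma> t)))"

text \<open>
  Joint Gaussianity of a finite family, degenerate case included: every linear combination
  has a (possibly degenerate) Gaussian law.
\<close>

definition jointly_gaussian :: "'a measure \<Rightarrow> 'i set \<Rightarrow> ('i \<Rightarrow> 'a \<Rightarrow> real) \<Rightarrow> bool" where
  "jointly_gaussian M I Z \<longleftrightarrow>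
     (\<forall>i\<in>I. Z i \<in> borel_measurable M) \<and>
     (\<forall>c :: 'i \<Rightarrow> real. gaussian_measure (distr M borel (\<lambda>\<omega>. \<Sum>i\<in>I. c i * Z i \<omega>)))"

definition generated_algebra :: "'a measure \<Rightarrow> 'i set \<Rightarrow> ('i \<Rightarrow> 'a \<Rightarrow> real) \<Rightarrow> 'a measure" where
  "generated_algebra M I Z =
     vimage_algebra (space M) (\<lambda>\<omega>. \<lambda>i\<in>I. Z i \<omega>) (\<Pi>\<^sub>M i\<in>I. (borel :: real measure))"

definition cond_prob_given :: "'a measure \<Rightarrow> 'a measure \<Rightarrow> 'a set \<Rightarrow> 'a \<Rightarrow> real" where
  "cond_prob_given M F A = real_cond_exp M F (indicator A)"

definition cond_independent ::
    "'a measure \<Rightarrow> 'a measure \<Rightarrow> ('a \<Rightarrow> real) \<Rightarrow> ('a \<Rightarrow> real) \<Rightarrow> bool" where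
  "cond_independent M F X Y \<longleftrightarrow>
     (\<forall>A\<in>sets borel. \<forall>B\<in>sets borel. AE \<omega> in M.
        cond_prob_given M F ((X -` A \<inter> space M) \<inter> (Y -` B \<inter> space M)) \<omega> =
        cond_prob_given M F (X -` A \<inter> space M) \<omega> * cond_prob_given M F (Y -` B \<inter> space M) \<omega>)"

text \<open>
  A process indexed by $[0,\infty)$ is given by a function on all reals; its values at
  negative indices are irrelevant.
\<close>

definition gauss_markov_process :: "'a measure \<Rightarrow> (real \<Rightarrow> 'a \<Rightarrow> real) \<Rightarrow> bool" where
  "gauss_markov_process M f \<longleftrightarrow>
     (\<forall>X. finite X \<and> X \<subseteq> {0..} \<longrightarrow> jointly_gaussian M X f) \<and>
     (\<forall>x x' x''. 0 \<le> x \<and> x < x' \<and> x' < x'' \<longrightarrow>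
        cond_independent M (generated_algebra M {x'} f) (f x) (f x''))"

definition mean_fun :: "'a measure \<Rightarrow> (real \<Rightarrow> 'a \<Rightarrow> real) \<Rightarrow> real \<Rightarrow> real" where
  "mean_fun M f x = (\<integral>\<omega>. f x \<omega> \<partial>M)"

definition cov_fun :: "'a measure \<Rightarrow> (real \<Rightarrow> 'a \<Rightarrow> real) \<Rightarrow> real \<Rightarrow> real \<Rightarrow> real" where
  "cov_fun M f x x' = (\<integral>\<omega>. (f x \<omega> - mean_fun M f x) * (f x' \<omega> - mean_fun M f x') \<partial>M)"

definition var_fun :: "'a measure \<Rightarrow> (real \<Rightarrow> 'a \<Rightarrow> real) \<Rightarrow> real \<Rightarrow> real" where
  "var_fun M f x = cov_fun M f x x"

definition weight_vector ::
    "(real \<Rightarrow> real \<Rightarrow> real) \<Rightarrow> (real \<Rightarrow> real) \<Rightarrow> real \<Rightarrow> real \<Rightarrow> real \<Rightarrow> real ^ 2" where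
  "weight_vector C V x x' x'' =
     (1 / (V x' * V x'' - (C x' x'')\<^sup>2)) *\<^sub>R
     vector [C x x' * V x'' - C x x'' * C x' x'', C x x'' * V x' - C x x' * C x' x'']"

definition cond_cov ::
    "'a measure \<Rightarrow> 'a measure \<Rightarrow> ('a \<Rightarrow> real) \<Rightarrow> ('a \<Rightarrow> real) \<Rightarrow> 'a \<Rightarrow> real" where
  "cond_cov M F X Y =
     real_cond_exp M F (\<lambda>\<omega>. (X \<omega> - real_cond_exp M F X \<omega>) * (Y \<omega> - real_cond_exp M F Y \<omega>))"

definition cond_var :: "'a measure \<Rightarrow> 'a measure \<Rightarrow> ('a \<Rightarrow> real) \<Rightarrow> 'a \<Rightarrow> real" where
  "cond_var M F X = cond_cov M F X X"

definition cond_cov_matrix ::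
    "'a measure \<Rightarrow> 'a measure \<Rightarrow> ('a \<Rightarrow> real ^ 'n) \<Rightarrow> 'a \<Rightarrow> real ^ 'n ^ 'n" where
  "cond_cov_matrix M F Z \<omega> = (\<chi> i j. cond_cov M F (\<lambda>\<omega>. Z \<omega> $ i) (\<lambda>\<omega>. Z \<omega> $ j) \<omega>)"

definition regular_cond_distribution ::
    "'a measure \<Rightarrow> 'a measure \<Rightarrow> ('a \<Rightarrow> real) \<Rightarrow> ('a \<Rightarrow> real measure) \<Rightarrow> bool" where
  "regular_cond_distribution M F X K \<longleftrightarrow>
     K \<in> F \<rightarrow>\<^sub>M prob_algebra borel \<and>
     (\<forall>B\<in>sets borel. AE \<omega> in M. measure (K \<omega>) B = cond_prob_given M F (X -` B \<inter> space M) \<omega>)"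

text \<open>
  Regular conditional distributions of real random variables are almost surely unique, so it
  does not matter which one is chosen.
\<close>

definition cond_gaussian :: "'a measure \<Rightarrow> 'a measure \<Rightarrow> ('a \<Rightarrow> real) \<Rightarrow> bool" where
  "cond_gaussian M F X \<longleftrightarrow>
     (\<exists>K. regular_cond_distribution M F X K \<and> (AE \<omega> in M. gaussian_measure (K \<omega>)))"

end

theory Submission
  imports Defs
begin

text \<open>
  All random variables involved lie in a linear space of Gaussian variables, where uncorrelated
  finite families are independent, so that conditioning on $y_1,\dots,y_n$ amounts to orthogonal
  projection. The Markov property gives $C(s,u)V(t)=C(s,t)C(t,u)$ for $s\le t\le u$. Hence the
  residual of $f(x)$ after regression on the values at the neighbouring sampling points is
  uncorrelated with every $f(x_i)$, thus with every $y_i$, and so is independent of the data and of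
  the conditional residuals of those values. This yields both formulas.
\<close>

section \<open>Characteristic functions and independence\<close>

text \<open>Joint Gaussianity is available only through the laws of linear combinations, and every
  covariance matrix may be singular: sampling points may coincide, errors may be degenerate. Hence
  neither densities nor inverse matrices can carry the argument. Characteristic functions treat
  degenerate and nondegenerate laws alike and turn zero covariance into independence; regression
  coefficients are built by successive orthogonalisation. The Markov property speaks of conditional
  probabilities of events, whereas the covariance identity concerns unbounded variables. The
  regression residual is therefore tested against events before it is tested against the variables
  themselves. The weights in (i) to (iii) solve the normal equations at the neighbouring points
  alone. Multiplying such an equation by a ratio of covariances produces the normal equation at any
  sampling point further out.\<close>

lemma char_normal:
  assumes "\<sigma> > 0"
  shows "char (density lborel (\<lambda>t. ennreal (normal_density a \<sigma> t))) t
    = exp (\<i> * t * a - t\<^sup>2 * \<sigma>\<^sup>2 / 2)"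
proof -
  interpret N: prob_space std_normal_distribution
    by (rule prob_space_normal_density) simp
  have D: "distributed std_normal_distribution lborel (\<lambda>x. x) std_normal_density"
    by (auto simp: distributed_def distr_id2 intro!: distr_cong)
  have "distributed std_normal_distribution lborel (\<lambda>x. a + \<sigma> * x)
      (normal_density (a + \<sigma> * 0) (\<bar>\<sigma>\<bar> * 1))"
    by (rule N.normal_density_affine[OF D]) (use assms in auto)
  then have *: "density lborel (normal_density a \<sigma>) = distr std_normal_distribution borel (\<lambda>x. a + \<sigma> * x)"
    using assms by (simp add: distributed_def cong: distr_cong)
  have "char (density lborel (normal_density a \<sigma>)) t
      = (CLINT x|std_normal_distribution. iexp (t * (a + \<sigma> * x)))"
    unfolding * char_def by (subst integral_distr) auto
  also have "\<dots> = (CLINT x|std_normal_distribution. iexp (t * a) * iexp ((t * \<sigma>) * x))"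
    by (simp add: exp_add[symmetric] algebra_simps)
  also have "\<dots> = iexp (t * a) * char std_normal_distribution (t * \<sigma>)"
    unfolding char_def by simp
  also have "\<dots> = exp (\<i> * t * a - t\<^sup>2 * \<sigma>\<^sup>2 / 2)"
    by (simp add: char_std_normal_distribution exp_add[symmetric] exp_of_real[symmetric] power_mult_distrib algebra_simps)
  finally show ?thesis .
qed

lemma char_return: "char (return borel a) t = iexp (t * a)"
  unfolding char_def by (subst integral_return) auto

lemma gaussian_measureI_char:
  fixes a :: real
  assumes "real_distribution \<mu>" "v \<ge> 0"
    and char: "\<And>t. char \<mu> t = exp (\<i> * t * a - t\<^sup>2 * v / 2)"
  shows "gaussian_measure \<mu>"
proof (cases "v = 0")
  case True
  have "\<mu> = return borel a"
    by (rule Levy_uniqueness[OF assms(1)])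
      (auto simp: real_distribution_def real_distribution_axioms_def prob_space_return fun_eq_iff
        char char_return True mult.assoc)
  then show ?thesis unfolding gaussian_measure_def by blast
next
  case False
  then have v: "sqrt v > 0" using assms by simp
  have "\<mu> = density lborel (normal_density a (sqrt v))"
    using v assms
    by (intro Levy_uniqueness[OF assms(1)])
      (auto simp: real_distribution_def real_distribution_axioms_def prob_space_normal_density fun_eq_iff
        char char_normal simp flip: of_real_power)
  then show ?thesis unfolding gaussian_measure_def using v by blast
qed

text \<open>Point masses and densities lead to the same expression in mean and variance, so that
  later arguments need not distinguish them.\<close>

lemma gaussian_measure_distr:
  assumes "prob_space M" and X[measurable]: "X \<in> borel_measurable M"
    and "gaussian_measure (distr M borel X)"
  shows "integrable M X" "integrable M (\<lambda>\<omega>. (X \<omega>)\<^sup>2)"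
    "char (distr M borel X) t =
      exp (\<i> * t * (\<integral>\<omega>. X \<omega> \<partial>M) - t\<^sup>2 * (\<integral>\<omega>. (X \<omega> - (\<integral>\<omega>. X \<omega> \<partial>M))\<^sup>2 \<partial>M) / 2)"
proof -
  interpret prob_space M by fact
  consider a where "distr M borel X = return borel a"
    | a \<sigma> where "\<sigma> > 0" "distr M borel X = density lborel (\<lambda>t. ennreal (normal_density a \<sigma> t))"
    using assms(3) unfolding gaussian_measure_def by blast
  then have "integrable M X \<and> integrable M (\<lambda>\<omega>. (X \<omega>)\<^sup>2) \<and> char (distr M borel X) t =
      exp (\<i> * t * expectation X - t\<^sup>2 * variance X / 2)"
  proof cases
    case 1
    have "AE x in distr M borel X. x = a"
      unfolding 1 by (subst AE_return) auto
    then have X: "AE \<omega> in M. X \<omega> = a"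
      by (subst (asm) AE_distr_iff) auto
    have 2: "integrable M X \<longleftrightarrow> integrable M (\<lambda>_. a)"
      "integrable M (\<lambda>\<omega>. (X \<omega>)\<^sup>2) \<longleftrightarrow> integrable M (\<lambda>_. a\<^sup>2)"
      by (intro integrable_cong_AE; use X in auto)+
    have E: "expectation X = expectation (\<lambda>_. a)"
      by (intro integral_cong_AE) (use X in auto)
    then have E: "expectation X = a" by (simp add: prob_space)
    have V: "variance X = expectation (\<lambda>_. 0)"
      using X by (intro integral_cong_AE) (auto simp: E)
    then have V: "expectation (\<lambda>\<omega>. (X \<omega> - a)\<^sup>2) = 0" by (simp add: E)
    show ?thesis using 2 unfolding E V 1 by (simp add: char_return mult.assoc)
  next
    case (2 a \<sigma>)
    have [measurable]: "X \<in> M \<rightarrow>\<^sub>M lborel" by simp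
    have D: "distributed M lborel X (normal_density a \<sigma>)"
      using 2 by (auto simp: distributed_def cong: distr_cong)
    have E: "expectation X = a" "variance X = \<sigma>\<^sup>2"
      using normal_distributed_expectation[OF 2(1) D] normal_distributed_variance[OF 2(1) D] by auto
    then have V: "expectation (\<lambda>\<omega>. (X \<omega> - a)\<^sup>2) = \<sigma>\<^sup>2" by simp
    have 3: "integrable M X"
      using distributed_integrable[OF D, of "\<lambda>x. x"] integrable_normal_moment_nz_1[OF 2(1), of a] by simp
    have 4: "integrable M (\<lambda>\<omega>. (X \<omega> - a)\<^sup>2)"
      using distributed_integrable[OF D, of "\<lambda>x. (x-a)\<^sup>2"] integrable_normal_moment[OF 2(1), of a 2] by simp
    have "integrable M (\<lambda>\<omega>. (X \<omega> - a)\<^sup>2 + 2 * a * X \<omega> - a\<^sup>2)"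
      using 3 4 by simp
    then have "integrable M (\<lambda>\<omega>. (X \<omega>)\<^sup>2)" by (simp add: power2_eq_square algebra_simps)
    with 3 show ?thesis unfolding E(1) V 2(2) char_normal[OF 2(1)] by simp
  qed
  then show "integrable M X" "integrable M (\<lambda>\<omega>. (X \<omega>)\<^sup>2)" 
    "char (distr M borel X) t = exp (\<i> * t * expectation X - t\<^sup>2 * variance X / 2)"
    by auto
qed

section \<open>From vanishing Fourier transforms to factorisation on boxes\<close>

context prob_space
begin

lemma integrable_bounded_mult_iexp:
  fixes W :: "'a \<Rightarrow> complex"
  assumes [measurable]: "W \<in> borel_measurable M" and "\<And>\<omega>. norm (W \<omega>) \<le> c"
    and [measurable]: "Y \<in> borel_measurable M"
  shows "integrable M (\<lambda>\<omega>. W \<omega> * iexp (Y \<omega>))"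
  by (rule integrable_const_bound[where B=c]) (use assms in \<open>auto simp: norm_mult\<close>)

lemma iexp_orthogonal_imp_indicator_real:
  fixes W Y :: "'a \<Rightarrow> real"
  assumes W[measurable]: "W \<in> borel_measurable M" and bound: "\<And>\<omega>. \<bar>W \<omega>\<bar> \<le> c"
    and Y[measurable]: "Y \<in> borel_measurable M" and A[measurable]: "A \<in> sets borel"
    and orth: "\<And>t. (CLINT \<omega>|M. W \<omega> * iexp (t * Y \<omega>)) = 0"
  shows "(LINT \<omega>|M. W \<omega> * indicator A (Y \<omega>)) = 0"
proof -
  \<comment> \<open>The reweighted probability \<open>(1 + W / d) M\<close> gives \<open>Y\<close> the same characteristic function as \<open>M\<close>.\<close>
  define d where "d = \<bar>c\<bar> + 1"
  have d: "d > 0" unfolding d_def by simp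
  have b: "\<bar>W \<omega>\<bar> \<le> d" for \<omega> using bound[of \<omega>] unfolding d_def by linarith
  define h where "h \<omega> = 1 + W \<omega> / d" for \<omega>
  have hm[measurable]: "h \<in> borel_measurable M" unfolding h_def by simp
  \<comment> \<open>The summand 1 in \<open>d\<close> keeps it positive even for
    \<open>c = 0\<close>, and \<open>d\<close> dominates \<open>W\<close>, so the density
    \<open>h\<close> is nonnegative.\<close>
  have h0: "h \<omega> \<ge> 0" for \<omega> using b[of \<omega>] d unfolding h_def by (auto simp: field_simps abs_le_iff)
  have iW: "integrable M (\<lambda>\<omega>. W \<omega> * g \<omega>)" if "g \<in> borel_measurable M" "\<And>\<omega>. \<bar>g \<omega>\<bar> \<le> 1" for g
    by (rule integrable_const_bound[where B=d])
      (use that b d in \<open>auto simp: abs_mult intro!: mult_le_one order_trans[OF mult_mono[of "\<bar>W _\<bar>" d "\<bar>g _\<bar>" 1]]\<close>)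
  have iW1: "integrable M W" using iW[of "\<lambda>_. 1"] by simp
  \<comment> \<open>Orthogonality at frequency zero says that \<open>W\<close> has mean zero, which
    gives \<open>h\<close> total mass one.\<close>
  have "of_real (LINT \<omega>|M. W \<omega>) = (0::complex)"
    using orth[of 0] by simp
  then have EW: "(LINT \<omega>|M. W \<omega>) = 0" by simp
  have ih: "integrable M h" unfolding h_def using iW1 by simp
  have Eh: "(LINT \<omega>|M. h \<omega>) = 1" unfolding h_def using iW1 EW by (simp add: prob_space)
  define N where "N = density M (\<lambda>\<omega>. ennreal (h \<omega>))"
  have [measurable_cong, simp]: "sets N = sets M" "space N = space M" unfolding N_def by auto
  interpret N: prob_space N
  proof
    show "emeasure N (space N) = 1"
      unfolding N_def using h0 ih by (simp add: emeasure_density nn_integral_eq_integral Eh cong: nn_integral_cong)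
  qed
  have "distr N borel Y = distr M borel Y"
  proof (rule Levy_uniqueness)
    show "real_distribution (distr N borel Y)" "real_distribution (distr M borel Y)"
      by (auto intro!: real_distribution_distr N.real_distribution_distr)
    show "char (distr N borel Y) = char (distr M borel Y)"
    proof
      fix t
      have 1: "integrable M (\<lambda>\<omega>. iexp (t * Y \<omega>))" by (rule integrable_iexp) auto
      have 2: "integrable M (\<lambda>\<omega>. complex_of_real (W \<omega>) * iexp (t * Y \<omega>))"
        by (rule integrable_bounded_mult_iexp[where c=d]) (use b in auto)
      have "char (distr N borel Y) t = (CLINT \<omega>|N. iexp (t * Y \<omega>))"
        unfolding char_def by (subst integral_distr) auto
      also have "\<dots> = (CLINT \<omega>|M. h \<omega> *\<^sub>R iexp (t * Y \<omega>))"
        unfolding N_def by (subst integral_density) (use h0 in auto)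
      also have "\<dots> = (CLINT \<omega>|M. iexp (t * Y \<omega>) + (W \<omega> * iexp (t * Y \<omega>)) / d)"
        unfolding h_def by (intro Bochner_Integration.integral_cong) (auto simp: scaleR_conv_of_real algebra_simps)
      also have "\<dots> = (CLINT \<omega>|M. iexp (t * Y \<omega>)) + (CLINT \<omega>|M. W \<omega> * iexp (t * Y \<omega>)) / d"
        using 1 2 by simp
      also have "\<dots> = char (distr M borel Y) t"
        unfolding orth char_def by (subst integral_distr) auto
      finally show "char (distr N borel Y) t = char (distr M borel Y) t" .
    qed
  qed
  then have "measure (distr N borel Y) A = measure (distr M borel Y) A" by simp
  then have "(LINT x|distr N borel Y. indicator A x) = (LINT x|distr M borel Y. indicator A x :: real)"
    by simp
  then have "(LINT \<omega>|N. indicator A (Y \<omega>)) = (LINT \<omega>|M. indicator A (Y \<omega>) :: real)"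
    by (subst (asm) (1 2) integral_distr) auto
  also have "(LINT \<omega>|N. indicator A (Y \<omega>)) = (LINT \<omega>|M. h \<omega> *\<^sub>R indicator A (Y \<omega>) :: real)"
    unfolding N_def by (subst integral_density) (use h0 in auto)
  also have "\<dots> = (LINT \<omega>|M. indicator A (Y \<omega>) + (W \<omega> * indicator A (Y \<omega>)) / d)"
    unfolding h_def by (intro Bochner_Integration.integral_cong) (auto simp: algebra_simps)
  also have "\<dots> = (LINT \<omega>|M. indicator A (Y \<omega>)) + (LINT \<omega>|M. W \<omega> * indicator A (Y \<omega>)) / d"
  proof (subst Bochner_Integration.integral_add)
    show "integrable M (\<lambda>\<omega>. indicator A (Y \<omega>) :: real)"
      by (rule integrable_const_bound[where B=1]) auto
    show "integrable M (\<lambda>\<omega>. W \<omega> * indicator A (Y \<omega>) / d)"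
      by (intro integrable_divide iW) (auto simp: indicator_def)
  qed simp
  finally show ?thesis using d by simp
qed

text \<open>The induction over coordinates multiplies weights by exponentials, so complex weights
  are unavoidable. Conjugating the hypothesis at \<open>-t\<close> shows that \<open>cnj W\<close>
  satisfies it as well, hence so do the real and imaginary parts, and the real case applies to
  each.\<close>

lemma iexp_orthogonal_imp_indicator:
  fixes W :: "'a \<Rightarrow> complex" and Y :: "'a \<Rightarrow> real"
  assumes W[measurable]: "W \<in> borel_measurable M" and bound: "\<And>\<omega>. norm (W \<omega>) \<le> c"
    and Y[measurable]: "Y \<in> borel_measurable M" and A[measurable]: "A \<in> sets borel"
    and orth: "\<And>t. (CLINT \<omega>|M. W \<omega> * iexp (t * Y \<omega>)) = 0"
  shows "(CLINT \<omega>|M. W \<omega> * indicator A (Y \<omega>)) = 0"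
proof -
  have i1: "integrable M (\<lambda>\<omega>. W \<omega> * iexp (t * Y \<omega>))" for t
    by (rule integrable_bounded_mult_iexp[where c=c]) (use bound in auto)
  have [measurable]: "cnj \<in> borel_measurable borel"
    by (intro borel_measurable_continuous_onI continuous_intros)
  have i2: "integrable M (\<lambda>\<omega>. cnj (W \<omega>) * iexp (t * Y \<omega>))" for t
    by (rule integrable_bounded_mult_iexp[where c=c]) (use bound in auto)
  have cnj: "(CLINT \<omega>|M. cnj (W \<omega>) * iexp (t * Y \<omega>)) = 0" for t
  proof -
    have "(CLINT \<omega>|M. cnj (W \<omega>) * iexp (t * Y \<omega>)) = (CLINT \<omega>|M. cnj (W \<omega> * iexp ((-t) * Y \<omega>)))"
      by (intro Bochner_Integration.integral_cong) (auto simp: exp_cnj)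
    also have "\<dots> = cnj (CLINT \<omega>|M. W \<omega> * iexp ((-t) * Y \<omega>))"
      by (rule integral_bounded_linear'[OF bounded_linear_cnj bounded_linear_cnj]) auto
    finally show ?thesis using orth[of "-t"] by simp
  qed
  have re: "(LINT \<omega>|M. Re (W \<omega>) * indicator A (Y \<omega>)) = 0"
  proof (rule iexp_orthogonal_imp_indicator_real[where c=c])
    fix t
    have "(CLINT \<omega>|M. Re (W \<omega>) * iexp (t * Y \<omega>))
      = (CLINT \<omega>|M. (W \<omega> * iexp (t * Y \<omega>) + cnj (W \<omega>) * iexp (t * Y \<omega>)) / 2)"
      by (intro Bochner_Integration.integral_cong) (auto simp: complex_add_cnj simp flip: distrib_right)
    also have "\<dots> = 0" using i1 i2 by (simp add: cnj orth del: of_real_mult)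
    finally show "(CLINT \<omega>|M. Re (W \<omega>) * iexp (t * Y \<omega>)) = 0" .
  qed (use bound in \<open>auto intro: order_trans[OF abs_Re_le_cmod]\<close>)
  have im: "(LINT \<omega>|M. Im (W \<omega>) * indicator A (Y \<omega>)) = 0"
  proof (rule iexp_orthogonal_imp_indicator_real[where c=c])
    fix t
    have "(CLINT \<omega>|M. Im (W \<omega>) * iexp (t * Y \<omega>))
      = (CLINT \<omega>|M. (W \<omega> * iexp (t * Y \<omega>) - cnj (W \<omega>) * iexp (t * Y \<omega>)) / (2 * \<i>))"
    proof (intro Bochner_Integration.integral_cong refl)
      fix \<omega>
      have "complex_of_real (Im (W \<omega>)) = (W \<omega> - cnj (W \<omega>)) / (2 * \<i>)"
        by (simp add: complex_eq_iff)
      then show "Im (W \<omega>) * iexp (t * Y \<omega>)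
          = (W \<omega> * iexp (t * Y \<omega>) - cnj (W \<omega>) * iexp (t * Y \<omega>)) / (2 * \<i>)"
        by (simp only: left_diff_distrib[symmetric] times_divide_eq_left)
    qed
    also have "\<dots> = 0" using i1 i2 by (simp add: cnj orth del: of_real_mult)
    finally show "(CLINT \<omega>|M. Im (W \<omega>) * iexp (t * Y \<omega>)) = 0" .
  qed (use bound in \<open>auto intro: order_trans[OF abs_Im_le_cmod]\<close>)
  have i3: "integrable M (\<lambda>\<omega>. W \<omega> * indicator A (Y \<omega>))"
    by (rule integrable_const_bound[where B=c])
      (use bound order_trans[OF norm_ge_zero bound] in \<open>auto simp: indicator_def\<close>)
  have ri: "Re (indicator A z) = indicator A z" "Im (indicator A z) = 0" for z :: real
    by (auto simp: indicator_def)
  show ?thesis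
    by (rule complex_eqI)
      (use i3 re im in \<open>simp_all add: ri flip: integral_Re integral_Im\<close>)
qed

text \<open>Exponentials are traded for indicators one coordinate at a time. For coordinate
  \<open>j\<close> the exponential in the remaining coordinates is absorbed into the weight; the
  indicator thus gained becomes part of the weight for the induction hypothesis. This is why
  \<open>W\<close> is arbitrary in the induction.\<close>

lemma iexp_orthogonal_imp_rectangle:
  fixes W :: "'a \<Rightarrow> complex" and Y :: "'i \<Rightarrow> 'a \<Rightarrow> real"
  assumes "finite I" and "W \<in> borel_measurable M" and "\<And>\<omega>. norm (W \<omega>) \<le> c"
    and "\<And>i. i \<in> I \<Longrightarrow> Y i \<in> borel_measurable M"
    and "\<And>i. i \<in> I \<Longrightarrow> A i \<in> sets borel"
    and "\<And>t. (CLINT \<omega>|M. W \<omega> * iexp (\<Sum>i\<in>I. t i * Y i \<omega>)) = 0"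
  shows "(CLINT \<omega>|M. W \<omega> * (\<Prod>i\<in>I. indicator (A i) (Y i \<omega>))) = 0"
  using assms
proof (induction I arbitrary: W)
  case empty
  then show ?case by simp
next
  case (insert j I)
  note [measurable] = insert.prems(1)
  have Yj[measurable]: "Y j \<in> borel_measurable M" and Aj[measurable]: "A j \<in> sets borel"
    using insert.prems by auto
  have Ym[measurable]: "(\<lambda>\<omega>. \<Sum>i\<in>I. t i * Y i \<omega>) \<in> borel_measurable M" for t
    using insert.prems by (intro borel_measurable_sum) auto
  have "(CLINT \<omega>|M. W \<omega> * indicator (A j) (Y j \<omega>) * (\<Prod>i\<in>I. indicator (A i) (Y i \<omega>))) = 0"
  proof (rule insert.IH)
    show "norm (W \<omega> * indicator (A j) (Y j \<omega>)) \<le> c" for \<omega>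
      using insert.prems(2)[of \<omega>] order_trans[OF norm_ge_zero insert.prems(2)]
      by (auto simp: indicator_def)
    fix t :: "'i \<Rightarrow> real"
    note [measurable] = Ym[of t]
    have "(CLINT \<omega>|M. (W \<omega> * iexp (\<Sum>i\<in>I. t i * Y i \<omega>)) * indicator (A j) (Y j \<omega>)) = 0"
    proof (rule iexp_orthogonal_imp_indicator[where c=c])
      fix s
      have "(\<Sum>i\<in>insert j I. (t(j := s)) i * Y i \<omega>) = (\<Sum>i\<in>I. t i * Y i \<omega>) + s * Y j \<omega>" for \<omega>
        using insert.hyps by (auto intro!: sum.cong)
      then show "(CLINT \<omega>|M. W \<omega> * iexp (\<Sum>i\<in>I. t i * Y i \<omega>) * iexp (s * Y j \<omega>)) = 0"
        using insert.prems(5)[of "t(j := s)"] by (simp add: exp_add distrib_left mult.assoc)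
    qed (use insert.prems(2) in \<open>auto simp: norm_mult simp del: of_real_sum\<close>)
    then show "(CLINT \<omega>|M. W \<omega> * indicator (A j) (Y j \<omega>) * iexp (\<Sum>i\<in>I. t i * Y i \<omega>)) = 0"
      by (simp add: mult_ac)
  qed (use insert.prems in auto)
  then show ?case using insert.hyps by (simp add: mult_ac)
qed

text \<open>Centring turns a product formula into an orthogonality relation: the expectation of a
  product factorises exactly when one factor minus its mean is orthogonal to the other. Doing this
  for one family and then for the other replaces exponentials by indicators on both sides.\<close>

lemma prob_rectangle_factorises:
  fixes U :: "'j \<Rightarrow> 'a \<Rightarrow> real" and Z :: "'i \<Rightarrow> 'a \<Rightarrow> real"
  assumes fin: "finite J" "finite I"
    and U: "\<And>j. j \<in> J \<Longrightarrow> U j \<in> borel_measurable M"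
    and Z: "\<And>i. i \<in> I \<Longrightarrow> Z i \<in> borel_measurable M"
    and char: "\<And>s t. (CLINT \<omega>|M. iexp ((\<Sum>j\<in>J. s j * U j \<omega>) + (\<Sum>i\<in>I. t i * Z i \<omega>)))
      = (CLINT \<omega>|M. iexp (\<Sum>j\<in>J. s j * U j \<omega>)) * (CLINT \<omega>|M. iexp (\<Sum>i\<in>I. t i * Z i \<omega>))"
    and A: "\<And>j. j \<in> J \<Longrightarrow> A j \<in> sets borel" and B: "\<And>i. i \<in> I \<Longrightarrow> B i \<in> sets borel"
  shows "prob ({\<omega>\<in>space M. \<forall>j\<in>J. U j \<omega> \<in> A j} \<inter> {\<omega>\<in>space M. \<forall>i\<in>I. Z i \<omega> \<in> B i})
    = prob {\<omega>\<in>space M. \<forall>j\<in>J. U j \<omega> \<in> A j} * prob {\<omega>\<in>space M. \<forall>i\<in>I. Z i \<omega> \<in> B i}"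
proof -
  define a b where "a \<omega> = (\<Prod>j\<in>J. indicator (A j) (U j \<omega>) :: complex)"
    and "b \<omega> = (\<Prod>i\<in>I. indicator (B i) (Z i \<omega>) :: complex)" for \<omega>
  note [measurable] = fin U Z A B
  have [measurable]: "a \<in> borel_measurable M" unfolding a_def
    by (intro borel_measurable_prod measurable_compose[OF U borel_measurable_indicator]) (use A in auto)
  have [measurable]: "b \<in> borel_measurable M" unfolding b_def
    by (intro borel_measurable_prod measurable_compose[OF Z borel_measurable_indicator]) (use B in auto)
  have [measurable]: "(\<lambda>\<omega>. \<Sum>j\<in>J. s j * U j \<omega>) \<in> borel_measurable M" for s
    using U by (intro borel_measurable_sum) auto
  have [measurable]: "(\<lambda>\<omega>. \<Sum>i\<in>I. t i * Z i \<omega>) \<in> borel_measurable M" for t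
    using Z by (intro borel_measurable_sum) auto
  have an: "norm (a \<omega>) \<le> 1" for \<omega>
    unfolding a_def prod_norm[symmetric] by (rule prod_le_1) (auto simp: indicator_def)
  have bn: "norm (b \<omega>) \<le> 1" for \<omega>
    unfolding b_def prod_norm[symmetric] by (rule prod_le_1) (auto simp: indicator_def)
  have bi: "integrable M b" by (rule integrable_const_bound[where B=1]) (use bn in auto)
  have ai: "integrable M a" by (rule integrable_const_bound[where B=1]) (use an in auto)
  have abi: "integrable M (\<lambda>\<omega>. a \<omega> * b \<omega>)"
    by (rule integrable_const_bound[where B=1]) (use an bn in \<open>auto simp: norm_mult intro!: mult_le_one\<close>)
  have ie: "integrable M (\<lambda>\<omega>. iexp (Y \<omega>))" if "Y \<in> borel_measurable M" for Y
    using integrable_bounded_mult_iexp[of "\<lambda>_. 1" 1 Y] that by simp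
  have ibe: "integrable M (\<lambda>\<omega>. iexp (Y \<omega>) * b \<omega>)" if "Y \<in> borel_measurable M" for Y
    using integrable_bounded_mult_iexp[of b 1 Y] bn that by (simp add: mult.commute)
  have step1: "(CLINT \<omega>|M. iexp (\<Sum>j\<in>J. s j * U j \<omega>) * b \<omega>)
      = (CLINT \<omega>|M. iexp (\<Sum>j\<in>J. s j * U j \<omega>)) * (CLINT \<omega>|M. b \<omega>)" for s
  proof -
    define e where "e = (CLINT \<omega>|M. iexp (\<Sum>j\<in>J. s j * U j \<omega>))"
    have "(CLINT \<omega>|M. (iexp (\<Sum>j\<in>J. s j * U j \<omega>) - e) * (\<Prod>i\<in>I. indicator (B i) (Z i \<omega>))) = 0"
    proof (rule iexp_orthogonal_imp_rectangle[where c="1 + norm e"])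
      show "norm (iexp (\<Sum>j\<in>J. s j * U j \<omega>) - e) \<le> 1 + norm e" for \<omega>
        by (rule order_trans[OF norm_triangle_ineq4]) simp
      fix t :: "'i \<Rightarrow> real"
      have "(CLINT \<omega>|M. (iexp (\<Sum>j\<in>J. s j * U j \<omega>) - e) * iexp (\<Sum>i\<in>I. t i * Z i \<omega>))
        = (CLINT \<omega>|M. iexp ((\<Sum>j\<in>J. s j * U j \<omega>) + (\<Sum>i\<in>I. t i * Z i \<omega>)) - e * iexp (\<Sum>i\<in>I. t i * Z i \<omega>))"
        by (simp only: left_diff_distrib exp_add distrib_left of_real_add)
      also have "\<dots> = (CLINT \<omega>|M. iexp ((\<Sum>j\<in>J. s j * U j \<omega>) + (\<Sum>i\<in>I. t i * Z i \<omega>)))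
          - e * (CLINT \<omega>|M. iexp (\<Sum>i\<in>I. t i * Z i \<omega>))"
        by (subst Bochner_Integration.integral_diff) (auto intro!: ie simp del: of_real_add of_real_sum)
      finally show "(CLINT \<omega>|M. (iexp (\<Sum>j\<in>J. s j * U j \<omega>) - e) * iexp (\<Sum>i\<in>I. t i * Z i \<omega>)) = 0"
        unfolding char e_def by simp
    qed (use fin Z B in auto)
    then show ?thesis
      unfolding b_def[symmetric] by (simp add: left_diff_distrib ibe bi e_def del: of_real_sum)
  qed
  \<comment> \<open>The roles are exchanged: the centred \<open>b\<close> is now the weight, and
    \<open>step1\<close> says that it is orthogonal to all exponentials in \<open>U\<close>.\<close>
  have "(CLINT \<omega>|M. (b \<omega> - expectation b) * (\<Prod>j\<in>J. indicator (A j) (U j \<omega>))) = 0"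
  proof (rule iexp_orthogonal_imp_rectangle[where c="1 + norm (expectation b)"])
    show "norm (b \<omega> - expectation b) \<le> 1 + norm (expectation b)" for \<omega>
      using bn[of \<omega>] norm_triangle_ineq4[of "b \<omega>" "expectation b"] by linarith
    fix s :: "'j \<Rightarrow> real"
    show "(CLINT \<omega>|M. (b \<omega> - expectation b) * iexp (\<Sum>j\<in>J. s j * U j \<omega>)) = 0"
      using step1[of s] ibe[of "\<lambda>\<omega>. \<Sum>j\<in>J. s j * U j \<omega>"]
      by (simp add: left_diff_distrib ie mult.commute del: of_real_sum)
  qed (use fin U A in auto)
  then have *: "(CLINT \<omega>|M. a \<omega> * b \<omega>) = expectation a * expectation b"
    unfolding a_def[symmetric] using ai abi by (simp add: left_diff_distrib right_diff_distrib mult.commute)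
  have ra: "a \<omega> = of_real (indicator {\<omega>\<in>space M. \<forall>j\<in>J. U j \<omega> \<in> A j} \<omega>)" if "\<omega> \<in> space M" for \<omega>
    using that fin unfolding a_def by (auto simp: indicator_def intro!: prod.neutral)
  have rb: "b \<omega> = of_real (indicator {\<omega>\<in>space M. \<forall>i\<in>I. Z i \<omega> \<in> B i} \<omega>)" if "\<omega> \<in> space M" for \<omega>
    using that fin unfolding b_def by (auto simp: indicator_def intro!: prod.neutral)
  have [measurable]: "{\<omega>\<in>space M. \<forall>j\<in>J. U j \<omega> \<in> A j} \<in> events" "{\<omega>\<in>space M. \<forall>i\<in>I. Z i \<omega> \<in> B i} \<in> events"
    using fin U Z A B by (auto intro!: sets.sets_Collect_finite_All measurable_sets_borel[of _ M, folded vimage_def] simp: pred_def)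
  have "complex_of_real (prob ({\<omega>\<in>space M. \<forall>j\<in>J. U j \<omega> \<in> A j} \<inter> {\<omega>\<in>space M. \<forall>i\<in>I. Z i \<omega> \<in> B i}))
    = (CLINT \<omega>|M. a \<omega> * b \<omega>)"
    using ra rb by (simp add: indicator_inter_arith[symmetric] flip: of_real_mult cong: Bochner_Integration.integral_cong)
  moreover have "complex_of_real (prob {\<omega>\<in>space M. \<forall>j\<in>J. U j \<omega> \<in> A j}) = expectation a"
    using ra by (subst Bochner_Integration.integral_cong[OF refl ra]) (auto)
  moreover have "complex_of_real (prob {\<omega>\<in>space M. \<forall>i\<in>I. Z i \<omega> \<in> B i}) = expectation b"
    using rb by (subst Bochner_Integration.integral_cong[OF refl rb]) (auto)
  ultimately have "complex_of_real (prob ({\<omega>\<in>space M. \<forall>j\<in>J. U j \<omega> \<in> A j} \<inter> {\<omega>\<in>space M. \<forall>i\<in>I. Z i \<omega> \<in> B i}))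
    = complex_of_real (prob {\<omega>\<in>space M. \<forall>j\<in>J. U j \<omega> \<in> A j} * prob {\<omega>\<in>space M. \<forall>i\<in>I. Z i \<omega> \<in> B i})"
    using * by (simp only: of_real_mult)
  then show ?thesis by (simp only: of_real_eq_iff)
qed

end

section \<open>Sigma-algebras generated by finite families of variables\<close>

lemma space_generated_algebra [simp]: "space (generated_algebra M I Z) = space M"
  unfolding generated_algebra_def by simp

lemma measurable_generated_algebra:
  "i \<in> I \<Longrightarrow> Z i \<in> borel_measurable (generated_algebra M I Z)"
proof -
  assume i: "i \<in> I"
  have "(\<lambda>\<omega>. \<lambda>i\<in>I. Z i \<omega>) \<in> generated_algebra M I Z \<rightarrow>\<^sub>M (\<Pi>\<^sub>M i\<in>I. (borel :: real measure))"
    unfolding generated_algebra_def by (rule measurable_vimage_algebra1) (auto simp: space_PiM)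
  then have "(\<lambda>\<omega>. (\<lambda>i\<in>I. Z i \<omega>) i) \<in> borel_measurable (generated_algebra M I Z)"
    using i by (rule measurable_compose[OF _ measurable_component_singleton])
  then show ?thesis using i by simp
qed

lemma subalgebra_generated_algebra:
  assumes "\<And>i. i \<in> I \<Longrightarrow> Z i \<in> borel_measurable M"
  shows "subalgebra M (generated_algebra M I Z)"
  unfolding subalgebra_def
proof
  show "sets (generated_algebra M I Z) \<subseteq> sets M"
    unfolding generated_algebra_def
    by (rule sets_image_in_sets) (use assms in \<open>auto intro!: measurable_restrict\<close>)
qed simp

text \<open>For finitely many coordinates, boxes with one Borel condition per coordinate generate
  the product sigma-algebra, and taking preimages commutes with generation.\<close>

lemma sets_generated_algebra_finite:
  assumes "finite I"
  shows "sets (generated_algebra M I Z) = sigma_sets (space M)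
    {{\<omega>\<in>space M. \<forall>i\<in>I. Z i \<omega> \<in> B i} | B. \<forall>i\<in>I. B i \<in> sets borel}"
proof -
  let ?f = "\<lambda>\<omega>. \<lambda>i\<in>I. Z i \<omega>"
  have f: "?f \<in> space M \<rightarrow> (\<Pi>\<^sub>E i\<in>I. space (borel :: real measure))" by auto
  have "sets (generated_algebra M I Z) = {?f -` A \<inter> space M |A. A \<in> sets (\<Pi>\<^sub>M i\<in>I. (borel :: real measure))}"
    unfolding generated_algebra_def by (rule sets_vimage_algebra2) (auto simp: space_PiM)
  also have "\<dots> = sigma_sets (space M) {?f -` A \<inter> space M |A. A \<in> prod_algebra I (\<lambda>_. borel :: real measure)}"
    unfolding sets_PiM using sigma_sets_vimage_commute[OF f] by simp
  also have "{?f -` A \<inter> space M |A. A \<in> prod_algebra I (\<lambda>_. borel :: real measure)}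
      = {{\<omega>\<in>space M. \<forall>i\<in>I. Z i \<omega> \<in> B i} | B. \<forall>i\<in>I. B i \<in> sets borel}" (is "?L = ?R")
  proof -
    have *: "?f -` (\<Pi>\<^sub>E i\<in>I. B i) \<inter> space M = {\<omega>\<in>space M. \<forall>i\<in>I. Z i \<omega> \<in> B i}" for B
      by (auto simp: PiE_iff)
    have "?L = {?f -` (\<Pi>\<^sub>E i\<in>I. B i) \<inter> space M | B. B \<in> (\<Pi> i\<in>I. sets borel)}"
      unfolding prod_algebra_eq_finite[OF assms] by blast
    also have "\<dots> = ?R" unfolding * Pi_def by blast
    finally show ?thesis .
  qed
  finally show ?thesis .
qed

context prob_space
begin

text \<open>Boxes are stable under intersection, so the product formula on boxes extends to the
  sigma-algebras they generate.\<close>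

lemma indep_generated_algebras:
  fixes U :: "'j \<Rightarrow> 'a \<Rightarrow> real" and Z :: "'i \<Rightarrow> 'a \<Rightarrow> real"
  assumes fin: "finite J" "finite I"
    and U: "\<And>j. j \<in> J \<Longrightarrow> U j \<in> borel_measurable M"
    and Z: "\<And>i. i \<in> I \<Longrightarrow> Z i \<in> borel_measurable M"
    and char: "\<And>s t. (CLINT \<omega>|M. iexp ((\<Sum>j\<in>J. s j * U j \<omega>) + (\<Sum>i\<in>I. t i * Z i \<omega>)))
      = (CLINT \<omega>|M. iexp (\<Sum>j\<in>J. s j * U j \<omega>)) * (CLINT \<omega>|M. iexp (\<Sum>i\<in>I. t i * Z i \<omega>))"
  shows "indep_set (sets (generated_algebra M J U)) (sets (generated_algebra M I Z))"
proof -
  have stable: "Int_stable {{\<omega>\<in>space M. \<forall>i\<in>K. Y i \<omega> \<in> B i} | B. \<forall>i\<in>K. B i \<in> sets borel}"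
    for K :: "'k set" and Y :: "'k \<Rightarrow> 'a \<Rightarrow> real"
  proof (rule Int_stableI)
    fix a b
    assume "a \<in> {{\<omega>\<in>space M. \<forall>i\<in>K. Y i \<omega> \<in> B i} | B. \<forall>i\<in>K. B i \<in> sets borel}"
      and "b \<in> {{\<omega>\<in>space M. \<forall>i\<in>K. Y i \<omega> \<in> B i} | B. \<forall>i\<in>K. B i \<in> sets borel}"
    then obtain A B where
      "a = {\<omega>\<in>space M. \<forall>i\<in>K. Y i \<omega> \<in> A i}" "\<forall>i\<in>K. A i \<in> sets borel"
      "b = {\<omega>\<in>space M. \<forall>i\<in>K. Y i \<omega> \<in> B i}" "\<forall>i\<in>K. B i \<in> sets borel" by blast
    then show "a \<inter> b \<in> {{\<omega>\<in>space M. \<forall>i\<in>K. Y i \<omega> \<in> B i} | B. \<forall>i\<in>K. B i \<in> sets borel}"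
      by (intro CollectI exI[of _ "\<lambda>i. A i \<inter> B i"]) auto
  qed
  have ev: "{\<omega>\<in>space M. \<forall>i\<in>K. Y i \<omega> \<in> B i} \<in> events"
    if "finite K" "\<And>i. i \<in> K \<Longrightarrow> Y i \<in> borel_measurable M" "\<forall>i\<in>K. B i \<in> sets borel"
    for K :: "'k set" and Y :: "'k \<Rightarrow> 'a \<Rightarrow> real" and B
    using subalgebra_generated_algebra[of K Y M] that
    unfolding subalgebra_def sets_generated_algebra_finite[OF that(1)] by blast
  show ?thesis
    unfolding sets_generated_algebra_finite[OF fin(1)] sets_generated_algebra_finite[OF fin(2)]
  proof (intro indep_set_sigma_sets stable indep_setI)
    fix a b
    assume "a \<in> {{\<omega>\<in>space M. \<forall>i\<in>J. U i \<omega> \<in> B i} | B. \<forall>i\<in>J. B i \<in> sets borel}"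
      and "b \<in> {{\<omega>\<in>space M. \<forall>i\<in>I. Z i \<omega> \<in> B i} | B. \<forall>i\<in>I. B i \<in> sets borel}"
    then show "prob (a \<inter> b) = prob a * prob b"
      using prob_rectangle_factorises[OF fin U Z char] by blast
  qed (use ev fin U Z in blast)+
qed

text \<open>The preimages under \<open>X\<close> and \<open>Y\<close> generate sigma-algebras
  contained in \<open>F\<close> and \<open>G\<close>, and independence is inherited by smaller
  families.\<close>

lemma indep_set_imp_indep_var:
  assumes "indep_set (sets F) (sets G)" and "space F = space M" "space G = space M"
    and X: "X \<in> F \<rightarrow>\<^sub>M S" and Y: "Y \<in> G \<rightarrow>\<^sub>M T"
  shows "indep_var S X T Y"
proof -
  have sub: "subalgebra M F" "subalgebra M G"
    using indep_setD_ev1[OF assms(1)] indep_setD_ev2[OF assms(1)] assms(2,3)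
    by (auto simp: subalgebra_def)
  have XM: "X \<in> M \<rightarrow>\<^sub>M S" and YM: "Y \<in> M \<rightarrow>\<^sub>M T"
    using measurable_from_subalg sub X Y by blast+
  have s1: "sigma_sets (space M) {X -` A \<inter> space M |A. A \<in> sets S} \<subseteq> sets F"
    using measurable_sets[OF X] assms(2) sets.top[of F] by (intro sets.sigma_sets_subset'[of _ F, simplified]) auto
  have s2: "sigma_sets (space M) {Y -` A \<inter> space M |A. A \<in> sets T} \<subseteq> sets G"
    using measurable_sets[OF Y] assms(3) sets.top[of G] by (intro sets.sigma_sets_subset'[of _ G, simplified]) auto
  show ?thesis unfolding indep_var_eq
  proof (intro conjI XM YM indep_setI)
    fix a b assume "a \<in> sigma_sets (space M) {X -` A \<inter> space M |A. A \<in> sets S}"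
      "b \<in> sigma_sets (space M) {Y -` A \<inter> space M |A. A \<in> sets T}"
    then show "prob (a \<inter> b) = prob a * prob b"
      using s1 s2 by (intro indep_setD[OF assms(1)]) auto
  qed (use s1 s2 sub in \<open>auto simp: subalgebra_def\<close>)
qed

lemma finite_measure_subalgebraI: "subalgebra M F \<Longrightarrow> finite_measure_subalgebra M F"
  by unfold_locales

lemma sigma_finite_subalgebraI: "subalgebra M F \<Longrightarrow> sigma_finite_subalgebra M F"
  using finite_measure_subalgebraI by (rule finite_measure_subalgebra_is_sigma_finite)

lemma real_cond_exp_indep:
  fixes X :: "'a \<Rightarrow> real"
  assumes ind: "indep_set (sets F) (sets G)" and sp: "space F = space M" "space G = space M"
    and X: "X \<in> borel_measurable F" "integrable M X"
  shows "AE \<omega> in M. real_cond_exp M G X \<omega> = expectation X"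
proof -
  have sub: "subalgebra M G"
    using indep_setD_ev2[OF ind] sp by (auto simp: subalgebra_def)
  interpret G: sigma_finite_subalgebra M G by (rule sigma_finite_subalgebraI[OF sub])
  show ?thesis
  proof (rule G.real_cond_exp_charact)
    fix A assume A: "A \<in> sets G"
    then have AM: "A \<in> events" using sub by (auto simp: subalgebra_def)
    have iA: "integrable M (indicator A :: _ \<Rightarrow> real)"
      using AM by (intro integrable_const_bound[where B=1]) auto
    have "indep_var borel X borel (indicator A :: _ \<Rightarrow> real)"
      by (rule indep_set_imp_indep_var[OF ind sp X(1)]) (use A in simp)
    then have "expectation (\<lambda>\<omega>. X \<omega> * indicator A \<omega>) = expectation X * prob A"
      using indep_var_lebesgue_integral[of X "indicator A"] X(2) iA AM by simp
    then show "(LINT \<omega>:A|M. X \<omega>) = (LINT \<omega>:A|M. expectation X)"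
      using AM by (simp add: set_lebesgue_integral_def mult.commute)
  qed (use X in auto)
qed

end

section \<open>Linear spaces of Gaussian variables\<close>

definition covariance :: "'a measure \<Rightarrow> ('a \<Rightarrow> real) \<Rightarrow> ('a \<Rightarrow> real) \<Rightarrow> real" where
  "covariance M X Y = (\<integral>\<omega>. (X \<omega> - (\<integral>\<omega>. X \<omega> \<partial>M)) * (Y \<omega> - (\<integral>\<omega>. Y \<omega> \<partial>M)) \<partial>M)"

lemma covariance_commute: "covariance M X Y = covariance M Y X"
  unfolding covariance_def by (simp add: mult.commute)

text \<open>Gaussianity is demanded of single elements only; closure under linear combinations turns
  this into joint Gaussianity of every finite family in \<open>S\<close>. Constants belong to
  \<open>S\<close> so that predictors can carry an intercept.\<close>

locale gaussian_space = prob_space M for M :: "'a measure" +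
  fixes S :: "('a \<Rightarrow> real) set"
  assumes meas [measurable]: "X \<in> S \<Longrightarrow> X \<in> borel_measurable M"
    and gauss: "X \<in> S \<Longrightarrow> gaussian_measure (distr M borel X)"
    and const: "(\<lambda>_. c) \<in> S"
    and add: "X \<in> S \<Longrightarrow> Y \<in> S \<Longrightarrow> (\<lambda>\<omega>. X \<omega> + Y \<omega>) \<in> S"
    and scale: "X \<in> S \<Longrightarrow> (\<lambda>\<omega>. c * X \<omega>) \<in> S"
begin

lemma diff: "X \<in> S \<Longrightarrow> Y \<in> S \<Longrightarrow> (\<lambda>\<omega>. X \<omega> - Y \<omega>) \<in> S"
  using add[of X "\<lambda>\<omega>. (-1) * Y \<omega>"] scale[of Y "-1"] by simp

lemma sum: "(\<And>i. i \<in> I \<Longrightarrow> Z i \<in> S) \<Longrightarrow> (\<lambda>\<omega>. \<Sum>i\<in>I. c i * Z i \<omega>) \<in> S"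
proof (induction I rule: infinite_finite_induct)
  case (insert j I)
  then have "(\<lambda>\<omega>. c j * Z j \<omega> + (\<Sum>i\<in>I. c i * Z i \<omega>)) \<in> S"
    by (intro add scale) auto
  then show ?case using insert.hyps by simp
qed (use const in auto)

lemma integrable: "X \<in> S \<Longrightarrow> integrable M X"
  using gaussian_measure_distr(1)[OF prob_space_axioms meas gauss] .

lemma integrable_power2: "X \<in> S \<Longrightarrow> integrable M (\<lambda>\<omega>. (X \<omega>)\<^sup>2)"
  using gaussian_measure_distr(2)[OF prob_space_axioms meas gauss] .

lemma integrable_mult: "X \<in> S \<Longrightarrow> Y \<in> S \<Longrightarrow> integrable M (\<lambda>\<omega>. X \<omega> * Y \<omega>)"
proof -
  assume XY: "X \<in> S" "Y \<in> S"
  have "integrable M (\<lambda>\<omega>. ((X \<omega> + Y \<omega>)\<^sup>2 - (X \<omega>)\<^sup>2 - (Y \<omega>)\<^sup>2) / 2)"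
    using integrable_power2[OF add[OF XY]] integrable_power2[OF XY(1)] integrable_power2[OF XY(2)]
    by (intro integrable_divide Bochner_Integration.integrable_diff)
  then show ?thesis by (simp add: power2_eq_square algebra_simps)
qed

text \<open>Frequency 1 is enough, because \<open>S\<close> contains all multiples of its
  elements.\<close>

lemma integral_iexp:
  assumes "X \<in> S"
  shows "(CLINT \<omega>|M. iexp (X \<omega>)) = exp (\<i> * expectation X - covariance M X X / 2)"
proof -
  note [measurable] = meas[OF assms]
  have "(CLINT \<omega>|M. iexp (X \<omega>)) = char (distr M borel X) 1"
    unfolding char_def by (subst integral_distr) auto
  also have "\<dots> = exp (\<i> * expectation X - covariance M X X / 2)"
    unfolding gaussian_measure_distr(3)[OF prob_space_axioms meas[OF assms] gauss[OF assms]]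
    by (simp add: covariance_def power2_eq_square)
  finally show ?thesis .
qed

section \<open>Covariance as a bilinear form on the Gaussian space\<close>

lemma covariance_eq:
  assumes "X \<in> S" "Y \<in> S"
  shows "covariance M X Y = expectation (\<lambda>\<omega>. X \<omega> * Y \<omega>) - expectation X * expectation Y"
proof -
  have "covariance M X Y = expectation (\<lambda>\<omega>. X \<omega> * Y \<omega> - expectation Y * X \<omega> - expectation X * Y \<omega>
      + expectation X * expectation Y)"
    unfolding covariance_def by (intro Bochner_Integration.integral_cong) (auto simp: algebra_simps)
  also have "\<dots> = expectation (\<lambda>\<omega>. X \<omega> * Y \<omega>) - expectation X * expectation Y"
    using assms integrable_mult[OF assms] by (simp add: integrable prob_space)
  finally show ?thesis .
qed

lemma covariance_add_left:
  assumes "X \<in> S" "Y \<in> S" "Z \<in> S"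
  shows "covariance M (\<lambda>\<omega>. X \<omega> + Y \<omega>) Z = covariance M X Z + covariance M Y Z"
  using assms by (simp add: covariance_eq add integrable integrable_mult distrib_right)

lemma covariance_scale_left:
  assumes "X \<in> S" "Z \<in> S"
  shows "covariance M (\<lambda>\<omega>. c * X \<omega>) Z = c * covariance M X Z"
  using assms by (simp add: covariance_eq scale right_diff_distrib mult.assoc)

lemma covariance_const_left: "covariance M (\<lambda>_. c) Z = 0"
  unfolding covariance_def by (simp add: prob_space)

lemma covariance_diff_left:
  assumes "X \<in> S" "Y \<in> S" "Z \<in> S"
  shows "covariance M (\<lambda>\<omega>. X \<omega> - Y \<omega>) Z = covariance M X Z - covariance M Y Z"
  using covariance_add_left[OF assms(1) scale[of Y "-1"] assms(3)] assms
    covariance_scale_left[of Y Z "-1"] by simp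

lemma covariance_sum_left:
  assumes "\<And>i. i \<in> I \<Longrightarrow> Y i \<in> S" "Z \<in> S"
  shows "covariance M (\<lambda>\<omega>. \<Sum>i\<in>I. c i * Y i \<omega>) Z = (\<Sum>i\<in>I. c i * covariance M (Y i) Z)"
  using assms(1)
proof (induction I rule: infinite_finite_induct)
  case (insert j I)
  then show ?case
    using covariance_add_left[of "\<lambda>\<omega>. c j * Y j \<omega>" "\<lambda>\<omega>. \<Sum>i\<in>I. c i * Y i \<omega>" Z] assms(2)
    by (simp add: scale sum covariance_scale_left)
qed (simp_all add: covariance_const_left)

lemma covariance_add_right:
  assumes "X \<in> S" "Y \<in> S" "Z \<in> S"
  shows "covariance M Z (\<lambda>\<omega>. X \<omega> + Y \<omega>) = covariance M Z X + covariance M Z Y"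
  using covariance_add_left[OF assms] by (simp add: covariance_commute)

lemma covariance_diff_right:
  assumes "X \<in> S" "Y \<in> S" "Z \<in> S"
  shows "covariance M Z (\<lambda>\<omega>. X \<omega> - Y \<omega>) = covariance M Z X - covariance M Z Y"
  using covariance_diff_left[OF assms] by (simp add: covariance_commute)

lemma covariance_sum_right:
  assumes "\<And>i. i \<in> I \<Longrightarrow> Y i \<in> S" "Z \<in> S"
  shows "covariance M Z (\<lambda>\<omega>. \<Sum>i\<in>I. c i * Y i \<omega>) = (\<Sum>i\<in>I. c i * covariance M Z (Y i))"
  using covariance_sum_left[OF assms] by (simp add: covariance_commute)

lemma covariance_const_right: "covariance M Z (\<lambda>_. c) = 0"
  using covariance_const_left by (simp add: covariance_commute)

text \<open>A variable of zero variance equals its mean almost surely. This legitimises a zero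
  regression coefficient in singular situations.\<close>

lemma covariance_eq_0_degenerate:
  assumes "X \<in> S" "Y \<in> S" "covariance M Y Y = 0"
  shows "covariance M X Y = 0"
proof -
  let ?Y = "\<lambda>\<omega>. Y \<omega> - expectation Y"
  have "?Y \<in> S" using assms diff const by auto
  then have i: "integrable M (\<lambda>\<omega>. ?Y \<omega> * ?Y \<omega>)" by (intro integrable_mult)
  have "AE \<omega> in M. ?Y \<omega> * ?Y \<omega> = 0"
    using assms(3) i unfolding covariance_def by (subst (asm) integral_nonneg_eq_0_iff_AE) auto
  then have "covariance M X Y = (LINT \<omega>|M. 0)"
    unfolding covariance_def using assms by (intro integral_cong_AE) auto
  then show ?thesis by simp
qed

text \<open>Variances of uncorrelated combinations add, so the Gaussian characteristic function
  factorises. Membership of both families in the same space \<open>S\<close> makes the combined sum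
  Gaussian.\<close>

theorem uncorrelated_imp_indep:
  fixes U :: "'j \<Rightarrow> 'a \<Rightarrow> real" and Z :: "'i \<Rightarrow> 'a \<Rightarrow> real"
  assumes fin: "finite J" "finite I"
    and U: "\<And>j. j \<in> J \<Longrightarrow> U j \<in> S" and Z: "\<And>i. i \<in> I \<Longrightarrow> Z i \<in> S"
    and cov: "\<And>i j. i \<in> I \<Longrightarrow> j \<in> J \<Longrightarrow> covariance M (U j) (Z i) = 0"
  shows "indep_set (sets (generated_algebra M J U)) (sets (generated_algebra M I Z))"
proof (rule indep_generated_algebras[OF fin])
  fix s :: "'j \<Rightarrow> real" and t :: "'i \<Rightarrow> real"
  let ?X = "\<lambda>\<omega>. \<Sum>j\<in>J. s j * U j \<omega>" and ?Y = "\<lambda>\<omega>. \<Sum>i\<in>I. t i * Z i \<omega>"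
  have XY: "?X \<in> S" "?Y \<in> S" using U Z by (auto intro: sum)
  have "covariance M ?X ?Y = 0"
    using U Z cov XY by (simp add: covariance_sum_left covariance_sum_right)
  then have "covariance M (\<lambda>\<omega>. ?X \<omega> + ?Y \<omega>) (\<lambda>\<omega>. ?X \<omega> + ?Y \<omega>) = covariance M ?X ?X + covariance M ?Y ?Y"
    using XY add[OF XY] by (simp add: covariance_add_left covariance_add_right covariance_commute)
  moreover have "expectation (\<lambda>\<omega>. ?X \<omega> + ?Y \<omega>) = expectation ?X + expectation ?Y"
    using XY by (intro Bochner_Integration.integral_add integrable)
  ultimately show "(CLINT \<omega>|M. iexp (?X \<omega> + ?Y \<omega>)) = (CLINT \<omega>|M. iexp (?X \<omega>)) * (CLINT \<omega>|M. iexp (?Y \<omega>))"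
    unfolding integral_iexp[OF add[OF XY]] integral_iexp[OF XY(1)] integral_iexp[OF XY(2)]
    by (simp only: exp_add[symmetric] of_real_add) (simp add: algebra_simps add_divide_distrib)
qed (use U Z in \<open>auto intro: meas\<close>)

text \<open>Gram-Schmidt orthogonalisation, which tolerates singular covariance matrices.
  \<open>Z'\<close> is \<open>Z k\<close> with its component along the earlier variables removed;
  correcting the residual \<open>X'\<close> along \<open>Z'\<close> kills the covariance with
  \<open>Z k\<close> without spoiling the others. The induction hypothesis serves for both
  \<open>X\<close> and \<open>Z k\<close>, hence the generalisation over \<open>X\<close>.\<close>

lemma orthogonal_coefficients:
  fixes Z :: "'i \<Rightarrow> 'a \<Rightarrow> real"
  assumes "finite I" "\<And>i. i \<in> I \<Longrightarrow> Z i \<in> S" "X \<in> S"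
  shows "\<exists>a. \<forall>i\<in>I. covariance M (\<lambda>\<omega>. X \<omega> - (\<Sum>j\<in>I. a j * Z j \<omega>)) (Z i) = 0"
  using assms
proof (induction I arbitrary: X)
  case empty
  then show ?case by simp
next
  case (insert k I)
  have ZS: "\<And>i. i \<in> I \<Longrightarrow> Z i \<in> S" "Z k \<in> S" using insert.prems by auto
  obtain a where a: "\<forall>i\<in>I. covariance M (\<lambda>\<omega>. X \<omega> - (\<Sum>j\<in>I. a j * Z j \<omega>)) (Z i) = 0"
    using insert.IH[OF ZS(1) insert.prems(2)] by blast
  obtain b where b: "\<forall>i\<in>I. covariance M (\<lambda>\<omega>. Z k \<omega> - (\<Sum>j\<in>I. b j * Z j \<omega>)) (Z i) = 0"
    using insert.IH[OF ZS(1) ZS(2)] by blast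
  define X' where "X' \<omega> = X \<omega> - (\<Sum>j\<in>I. a j * Z j \<omega>)" for \<omega>
  define Z' where "Z' \<omega> = Z k \<omega> - (\<Sum>j\<in>I. b j * Z j \<omega>)" for \<omega>
  \<comment> \<open>If \<open>Z'\<close> is degenerate, division by zero gives \<open>c = 0\<close>, which is still a valid coefficient.\<close>
  define c where "c = covariance M X' Z' / covariance M Z' Z'"
  define R where "R \<omega> = X' \<omega> - c * Z' \<omega>" for \<omega>
  have S: "X' \<in> S" "Z' \<in> S" "R \<in> S"
    unfolding R_def[abs_def] X'_def[abs_def] Z'_def[abs_def] using ZS insert.prems
    by (auto intro!: diff scale sum)
  have RI: "covariance M R (Z i) = 0" if "i \<in> I" for i
    using a b that S ZS unfolding R_def[abs_def]
    by (simp add: covariance_diff_left covariance_scale_left scale X'_def[symmetric] Z'_def[symmetric])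
  have "covariance M R Z' = covariance M X' Z' - c * covariance M Z' Z'"
    unfolding R_def[abs_def] using S by (simp add: covariance_diff_left covariance_scale_left scale)
  also have "\<dots> = 0"
    using covariance_eq_0_degenerate[OF S(1,2)] unfolding c_def by auto
  finally have RZ': "covariance M R Z' = 0" .
  have "Z k = (\<lambda>\<omega>. Z' \<omega> + (\<Sum>j\<in>I. b j * Z j \<omega>))" unfolding Z'_def by auto
  then have "covariance M R (Z k) = covariance M R Z' + (\<Sum>j\<in>I. b j * covariance M R (Z j))"
    using covariance_add_right[of Z' "\<lambda>\<omega>. \<Sum>j\<in>I. b j * Z j \<omega>" R] S ZS(1) sum[of I Z b]
    by (simp add: covariance_sum_right)
  then have Rk: "covariance M R (Z k) = 0" using RZ' RI by simp
  define d where "d j = (if j = k then c else a j - c * b j)" for j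
  have "(\<Sum>j\<in>I. d j * Z j \<omega>) = (\<Sum>j\<in>I. a j * Z j \<omega>) - c * (\<Sum>j\<in>I. b j * Z j \<omega>)" for \<omega>
    unfolding sum_distrib_left sum_subtractf[symmetric] using insert.hyps
    by (intro sum.cong) (auto simp: d_def algebra_simps)
  then have "(\<lambda>\<omega>. X \<omega> - (\<Sum>j\<in>insert k I. d j * Z j \<omega>)) = R"
    unfolding R_def[abs_def] X'_def Z'_def using insert.hyps
    by (auto simp: d_def algebra_simps)
  then show ?case using Rk RI by (intro exI[of _ d]) auto
qed

text \<open>An intercept is added to the projection so that \<open>L\<close> has the mean of
  \<open>X\<close>. The last property follows from \<open>L\<close> lying in the affine span of the
  \<open>Z i\<close> and spares later arguments the coefficients.\<close>

lemma linear_regression: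
  fixes Z :: "'i \<Rightarrow> 'a \<Rightarrow> real"
  assumes "finite I" and Z: "\<And>i. i \<in> I \<Longrightarrow> Z i \<in> S" and X: "X \<in> S"
  obtains L where "L \<in> S" "L \<in> borel_measurable (generated_algebra M I Z)"
    "expectation L = expectation X"
    "\<And>i. i \<in> I \<Longrightarrow> covariance M (\<lambda>\<omega>. X \<omega> - L \<omega>) (Z i) = 0"
    "\<And>R. R \<in> S \<Longrightarrow> \<forall>i\<in>I. covariance M R (Z i) = 0 \<Longrightarrow> covariance M R L = 0"
proof -
  obtain a where a: "\<And>i. i \<in> I \<Longrightarrow> covariance M (\<lambda>\<omega>. X \<omega> - (\<Sum>j\<in>I. a j * Z j \<omega>)) (Z i) = 0"
    using orthogonal_coefficients[where Z=Z, OF assms(1) Z X] by blast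
  define A where "A \<omega> = (\<Sum>j\<in>I. a j * Z j \<omega>)" for \<omega>
  define L where "L \<omega> = (expectation X - expectation A) + A \<omega>" for \<omega>
  have A: "A \<in> S" unfolding A_def[abs_def] using Z by (rule sum)
  have L: "L \<in> S" unfolding L_def[abs_def] using add[OF const A] .
  show thesis
  proof
    show "L \<in> S" by fact
    show "L \<in> borel_measurable (generated_algebra M I Z)"
      unfolding L_def[abs_def] A_def[abs_def] using measurable_generated_algebra[of _ I Z M]
      by (intro borel_measurable_add borel_measurable_sum borel_measurable_times) auto
    show "expectation L = expectation X"
      unfolding L_def[abs_def] using integrable[OF A] by (simp add: prob_space)
    show "covariance M (\<lambda>\<omega>. X \<omega> - L \<omega>) (Z i) = 0" if i: "i \<in> I" for i
    proof -
      have "(\<lambda>\<omega>. X \<omega> - L \<omega>) = (\<lambda>\<omega>. (X \<omega> - A \<omega>) - (expectation X - expectation A))"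
        unfolding L_def by auto
      then show ?thesis
        using covariance_diff_left[OF diff[OF X A] const Z[OF i], of "expectation X - expectation A"] a[OF i]
        by (simp add: covariance_const_left A_def)
    qed
    show "covariance M R L = 0" if "R \<in> S" "\<forall>i\<in>I. covariance M R (Z i) = 0" for R
      using covariance_add_right[OF const A that(1)] covariance_sum_right[of I Z R a, OF Z] that
      unfolding L_def[abs_def] by (simp add: covariance_const_right A_def[abs_def])
  qed
qed

section \<open>Conditional moments and conditional laws given finitely many Gaussian
  variables\<close>

lemma subalgebra_generated:
  "(\<And>i. i \<in> I \<Longrightarrow> Z i \<in> S) \<Longrightarrow> subalgebra M (generated_algebra M I Z)"
  by (intro subalgebra_generated_algebra meas)

lemma real_cond_exp_eq_regression:
  assumes I: "finite I" and Z: "\<And>i. i \<in> I \<Longrightarrow> Z i \<in> S" and X: "X \<in> S" and L: "L \<in> S"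
    and Lm: "L \<in> borel_measurable (generated_algebra M I Z)"
    and E: "expectation L = expectation X"
    and cov: "\<And>i. i \<in> I \<Longrightarrow> covariance M (\<lambda>\<omega>. X \<omega> - L \<omega>) (Z i) = 0"
  shows "AE \<omega> in M. real_cond_exp M (generated_algebra M I Z) X \<omega> = L \<omega>"
proof -
  let ?G = "generated_algebra M I Z" and ?R = "\<lambda>\<omega>. X \<omega> - L \<omega>"
  interpret G: sigma_finite_subalgebra M ?G
    by (intro sigma_finite_subalgebraI subalgebra_generated Z)
  have R: "?R \<in> S" by (rule diff[OF X L])
  have ind: "indep_set (sets (generated_algebra M {()} (\<lambda>_. ?R))) (sets ?G)"
    by (rule uncorrelated_imp_indep) (use I Z R cov in auto)
  have "AE \<omega> in M. real_cond_exp M ?G ?R \<omega> = expectation ?R"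
    by (rule real_cond_exp_indep[OF ind]) (use measurable_generated_algebra[of "()" "{()}" "\<lambda>_. ?R" M] integrable[OF R] in auto)
  moreover have "expectation ?R = 0" using E integrable[OF X] integrable[OF L] by simp
  moreover have "AE \<omega> in M. real_cond_exp M ?G (\<lambda>\<omega>. ?R \<omega> + L \<omega>) \<omega>
      = real_cond_exp M ?G ?R \<omega> + real_cond_exp M ?G L \<omega>"
    using integrable R L by (intro G.real_cond_exp_add)
  moreover have "AE \<omega> in M. real_cond_exp M ?G L \<omega> = L \<omega>"
    by (rule G.real_cond_exp_F_meas[OF integrable[OF L] Lm])
  ultimately show ?thesis by auto
qed

text \<open>The conditional covariance is deterministic because the two residuals are jointly
  independent of the data. Separate independence would not control their product, which is why they
  form one family indexed by booleans.\<close>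

lemma cond_cov_eq_covariance:
  assumes I: "finite I" and Z: "\<And>i. i \<in> I \<Longrightarrow> Z i \<in> S" and X: "X \<in> S" "X' \<in> S" and L: "L \<in> S" "L' \<in> S"
    and Lm: "L \<in> borel_measurable (generated_algebra M I Z)" "L' \<in> borel_measurable (generated_algebra M I Z)"
    and E: "expectation L = expectation X" "expectation L' = expectation X'"
    and cov: "\<And>i. i \<in> I \<Longrightarrow> covariance M (\<lambda>\<omega>. X \<omega> - L \<omega>) (Z i) = 0"
      "\<And>i. i \<in> I \<Longrightarrow> covariance M (\<lambda>\<omega>. X' \<omega> - L' \<omega>) (Z i) = 0"
  shows "AE \<omega> in M. cond_cov M (generated_algebra M I Z) X X' \<omega>
    = covariance M (\<lambda>\<omega>. X \<omega> - L \<omega>) (\<lambda>\<omega>. X' \<omega> - L' \<omega>)"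
proof -
  let ?G = "generated_algebra M I Z" and ?R = "\<lambda>\<omega>. X \<omega> - L \<omega>" and ?R' = "\<lambda>\<omega>. X' \<omega> - L' \<omega>"
  interpret G: sigma_finite_subalgebra M ?G
    by (intro sigma_finite_subalgebraI subalgebra_generated Z)
  have R: "?R \<in> S" "?R' \<in> S" using X L diff by auto
  define U where "U b = (if b then ?R else ?R')" for b
  have ind: "indep_set (sets (generated_algebra M UNIV U)) (sets ?G)"
    by (rule uncorrelated_imp_indep) (use I Z R cov in \<open>auto simp: U_def\<close>)
  note [measurable] = meas[OF X(1)] meas[OF X(2)] meas[OF R(1)] meas[OF R(2)]
  have "AE \<omega> in M. real_cond_exp M ?G (\<lambda>\<omega>. ?R \<omega> * ?R' \<omega>) \<omega> = expectation (\<lambda>\<omega>. ?R \<omega> * ?R' \<omega>)"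
  proof (rule real_cond_exp_indep[OF ind])
    have "U True \<in> borel_measurable (generated_algebra M UNIV U)" "U False \<in> borel_measurable (generated_algebra M UNIV U)"
      by (auto intro: measurable_generated_algebra)
    then show "(\<lambda>\<omega>. ?R \<omega> * ?R' \<omega>) \<in> borel_measurable (generated_algebra M UNIV U)"
      unfolding U_def by (intro borel_measurable_times) auto
  qed (use integrable_mult[OF R] in auto)
  moreover have "expectation (\<lambda>\<omega>. ?R \<omega> * ?R' \<omega>) = covariance M ?R ?R'"
    using E R X L by (subst covariance_eq) (simp_all add: integrable)
  moreover have "AE \<omega> in M. cond_cov M ?G X X' \<omega> = real_cond_exp M ?G (\<lambda>\<omega>. ?R \<omega> * ?R' \<omega>) \<omega>"
    unfolding cond_cov_def
  proof (rule G.real_cond_exp_cong)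
    show "AE \<omega> in M. (X \<omega> - real_cond_exp M ?G X \<omega>) * (X' \<omega> - real_cond_exp M ?G X' \<omega>) = ?R \<omega> * ?R' \<omega>"
      using real_cond_exp_eq_regression[where Z=Z, OF I Z X(1) L(1) Lm(1) E(1) cov(1)]
        real_cond_exp_eq_regression[where Z=Z, OF I Z X(2) L(2) Lm(2) E(2) cov(2)] by auto
  qed auto
  ultimately show ?thesis by auto
qed

text \<open>Given the data, the predictor \<open>L\<close> is known and the residual
  \<open>R\<close> keeps its unconditional law; the conditional law of \<open>X\<close> is therefore
  the law of \<open>R\<close> shifted by the observed value of \<open>L\<close>.\<close>

theorem cond_gaussian_generated_algebra:
  assumes I: "finite I" and Z: "\<And>i. i \<in> I \<Longrightarrow> Z i \<in> S" and X: "X \<in> S"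
  shows "cond_gaussian M (generated_algebra M I Z) X"
proof -
  let ?G = "generated_algebra M I Z"
  have sub: "subalgebra M ?G" using Z by (rule subalgebra_generated)
  interpret G: sigma_finite_subalgebra M ?G
    by (intro sigma_finite_subalgebraI sub)
  obtain L where L: "L \<in> S" and Lm[measurable]: "L \<in> borel_measurable ?G"
    and cov: "\<And>i. i \<in> I \<Longrightarrow> covariance M (\<lambda>\<omega>. X \<omega> - L \<omega>) (Z i) = 0"
    by (rule linear_regression[where Z=Z, OF I Z X]) (assumption, rule that)
  define R where "R \<omega> = X \<omega> - L \<omega>" for \<omega>
  have R: "R \<in> S" unfolding R_def[abs_def] by (rule diff[OF X L])
  note [measurable] = meas[OF R] meas[OF X] meas[OF L]
  let ?N = "distr M borel R"
  interpret N: prob_space ?N by (rule prob_space_distr) simp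
  define K where "K \<omega> = distr ?N borel (\<lambda>r. L \<omega> + r)" for \<omega>
  \<comment> \<open>As the image of a fixed law under a shift, the kernel is seen to be measurable;
    the form obtained here exhibits each \<open>K \<omega>\<close> as the law of an element of
    \<open>S\<close>, hence as Gaussian.\<close>
  have K_eq: "K \<omega> = distr M borel (\<lambda>\<omega>'. L \<omega> + R \<omega>')" for \<omega>
    unfolding K_def by (subst distr_distr) (auto simp: comp_def)
  have Km: "K \<in> ?G \<rightarrow>\<^sub>M prob_algebra borel"
    unfolding K_def[abs_def]
  proof (rule measurable_distr_prob_space2[where M=borel])
    show "(\<lambda>x. ?N) \<in> ?G \<rightarrow>\<^sub>M prob_algebra borel"
      by (rule measurable_const) (auto simp: space_prob_algebra N.prob_space_axioms)
  qed measurable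
  have ind: "indep_set (sets (generated_algebra M {()} (\<lambda>_. R))) (sets ?G)"
    by (rule uncorrelated_imp_indep) (use I Z R cov in \<open>auto simp: R_def[abs_def]\<close>)
  have "AE \<omega> in M. measure (K \<omega>) B = cond_prob_given M ?G (X -` B \<inter> space M) \<omega>"
    if B[measurable]: "B \<in> sets borel" for B
  proof -
    have KBm[measurable]: "(\<lambda>\<omega>. measure (K \<omega>) B) \<in> borel_measurable ?G"
      using measurable_compose[OF measurable_prob_algebraD[OF Km] measurable_measure_subprob_algebra[OF B]] .
    have XB[measurable]: "X -` B \<inter> space M \<in> events" by measurable
    have "AE \<omega> in M. real_cond_exp M ?G (indicator (X -` B \<inter> space M)) \<omega> = measure (K \<omega>) B"
    proof (rule G.real_cond_exp_charact)
      show "integrable M (indicator (X -` B \<inter> space M) :: _ \<Rightarrow> real)"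
        by (intro integrable_const_bound[where B=1]) auto
      show "integrable M (\<lambda>\<omega>. measure (K \<omega>) B)"
      proof (intro integrable_const_bound[where B=1])
        show "(\<lambda>\<omega>. measure (K \<omega>) B) \<in> borel_measurable M"
          by (rule measurable_from_subalg[OF sub KBm])
        have "prob_space (K \<omega>)" for \<omega> unfolding K_eq by (rule prob_space_distr) simp
        then show "AE \<omega> in M. norm (measure (K \<omega>) B) \<le> 1"
          by (auto simp: prob_space.prob_le_1)
      qed
      fix A assume A[measurable]: "A \<in> sets ?G"
      have AM: "A \<in> events" using A sub by (auto simp: subalgebra_def)
      \<comment> \<open>\<open>R\<close> is padded with a zero because \<open>indep_var\<close> wants both variables to have the same type.\<close>
      let ?T = "borel \<Otimes>\<^sub>M borel :: (real \<times> real) measure"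
      let ?X = "\<lambda>\<omega>. (R \<omega>, 0 :: real)" and ?Y = "\<lambda>\<omega>. (indicator A \<omega> :: real, L \<omega>)"
      have iv: "indep_var ?T ?X ?T ?Y"
      proof (rule indep_set_imp_indep_var[OF ind])
        show "?X \<in> generated_algebra M {()} (\<lambda>_. R) \<rightarrow>\<^sub>M ?T"
          using measurable_generated_algebra[of "()" "{()}" "\<lambda>_. R" M] by (intro measurable_Pair) auto
      qed auto
      have [measurable]: "?X \<in> M \<rightarrow>\<^sub>M ?T" "?Y \<in> M \<rightarrow>\<^sub>M ?T"
        using indep_var_rv1[OF iv] indep_var_rv2[OF iv] .
      interpret DX: prob_space "distr M ?T ?X" by (rule prob_space_distr) simp
      interpret DY: prob_space "distr M ?T ?Y" by (rule prob_space_distr) simp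
      interpret XY: pair_prob_space "distr M ?T ?X" "distr M ?T ?Y" ..
      have joint: "distr M (?T \<Otimes>\<^sub>M ?T) (\<lambda>\<omega>. (?X \<omega>, ?Y \<omega>)) = distr M ?T ?X \<Otimes>\<^sub>M distr M ?T ?Y"
        using iv unfolding indep_var_distribution_eq by simp
      \<comment> \<open>The first factor recovers the event \<open>A\<close> from the value 1 of its
        indicator, and the second is the indicator of \<open>B\<close> at \<open>L + R\<close>, that
        is at \<open>X\<close>. The product law of the two independent pairs then allows
        Fubini.\<close>
      let ?h = "\<lambda>x y. indicator {1} (fst y) * indicator B (snd y + fst x) :: real"
      have hm[measurable]: "(\<lambda>(x, y). ?h x y) \<in> borel_measurable (?T \<Otimes>\<^sub>M ?T)" by measurable
      have hi: "integrable (distr M ?T ?X \<Otimes>\<^sub>M distr M ?T ?Y) (\<lambda>(x, y). ?h x y)"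
        by (intro XY.P.integrable_const_bound[where B=1]) (auto simp: indicator_def)
      have "(LINT \<omega>:A|M. indicator (X -` B \<inter> space M) \<omega>) = (LINT \<omega>|M. (\<lambda>(x, y). ?h x y) (?X \<omega>, ?Y \<omega>))"
        unfolding set_lebesgue_integral_def R_def
        by (intro Bochner_Integration.integral_cong) (auto simp: indicator_def)
      also have "\<dots> = (LINT p|distr M (?T \<Otimes>\<^sub>M ?T) (\<lambda>\<omega>. (?X \<omega>, ?Y \<omega>)). (\<lambda>(x, y). ?h x y) p)"
        by (rule integral_distr[symmetric]) measurable
      also have "\<dots> = (LINT y|distr M ?T ?Y. (LINT x|distr M ?T ?X. ?h x y))"
        unfolding joint using XY.integral_snd[OF hi] by simp
      also have "\<dots> = (LINT \<omega>|M. (LINT x|distr M ?T ?X. ?h x (?Y \<omega>)))"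
        by (rule integral_distr) measurable
      also have "\<dots> = (LINT \<omega>:A|M. measure (K \<omega>) B)"
        unfolding set_lebesgue_integral_def
      proof (intro Bochner_Integration.integral_cong refl)
        fix \<omega>
        have "measure (K \<omega>) B = (LINT x|K \<omega>. indicator B x)" unfolding K_eq by simp
        also have "\<dots> = (LINT \<omega>'|M. indicator B (L \<omega> + R \<omega>'))"
          unfolding K_eq by (rule integral_distr) measurable
        finally have "measure (K \<omega>) B = (LINT \<omega>'|M. indicator B (L \<omega> + R \<omega>'))" .
        moreover have "(LINT x|distr M ?T ?X. ?h x (?Y \<omega>)) = (LINT \<omega>'|M. ?h (?X \<omega>') (?Y \<omega>))"
          by (rule integral_distr) measurable
        ultimately show "(LINT x|distr M ?T ?X. ?h x (?Y \<omega>)) = indicator A \<omega> *\<^sub>R measure (K \<omega>) B"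
          by (simp add: indicator_def)
      qed
      finally show "(LINT \<omega>:A|M. indicator (X -` B \<inter> space M) \<omega>) = (LINT \<omega>:A|M. measure (K \<omega>) B)" .
    qed (rule KBm)
    then show ?thesis unfolding cond_prob_given_def by auto
  qed
  moreover have "gaussian_measure (K \<omega>)" for \<omega>
    unfolding K_eq by (intro gauss add const R)
  ultimately show ?thesis
    unfolding cond_gaussian_def regular_cond_distribution_def using Km by (intro exI[of _ K]) auto
qed

text \<open>The \<open>P j\<close> are hidden, the data are the \<open>Z i\<close>, and
  \<open>L j\<close> is the projection of \<open>P j\<close> onto the data. What the
  \<open>P j\<close> leave unexplained in \<open>X\<close> is uncorrelated with both families, so
  the residual of \<open>X\<close> given the data splits into uncorrelated pieces \<open>R\<close>
  and \<open>W\<close>, where \<open>W\<close> combines the residuals of the \<open>P j\<close> with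
  the same weights. Their variances are the two terms of the variance formula.\<close>

theorem cond_exp_cond_var_via_predictors:
  fixes Z :: "'i \<Rightarrow> 'a \<Rightarrow> real" and P :: "'j \<Rightarrow> 'a \<Rightarrow> real"
  assumes I: "finite I" and Z: "\<And>i. i \<in> I \<Longrightarrow> Z i \<in> S"
    and J: "finite J" and P: "\<And>j. j \<in> J \<Longrightarrow> P j \<in> S" and X: "X \<in> S"
    and covP: "\<And>j. j \<in> J \<Longrightarrow> covariance M (\<lambda>\<omega>. X \<omega> - (\<Sum>j\<in>J. w j * P j \<omega>)) (P j) = 0"
    and covZ: "\<And>i. i \<in> I \<Longrightarrow> covariance M (\<lambda>\<omega>. X \<omega> - (\<Sum>j\<in>J. w j * P j \<omega>)) (Z i) = 0"
  shows "AE \<omega> in M. real_cond_exp M (generated_algebra M I Z) X \<omega>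
      = expectation X + (\<Sum>j\<in>J. w j * (real_cond_exp M (generated_algebra M I Z) (P j) \<omega> - expectation (P j)))" (is ?E)
    and "AE \<omega> in M. cond_var M (generated_algebra M I Z) X \<omega>
      = (\<Sum>j\<in>J. \<Sum>l\<in>J. w j * w l * cond_cov M (generated_algebra M I Z) (P j) (P l) \<omega>)
        + cond_var M (generated_algebra M J P) X \<omega>" (is ?V)
proof -
  let ?G = "generated_algebra M I Z"
  let ?pred = "\<lambda>j L. L \<in> S \<and> L \<in> borel_measurable ?G \<and> expectation L = expectation (P j) \<and>
      (\<forall>i\<in>I. covariance M (\<lambda>\<omega>. P j \<omega> - L \<omega>) (Z i) = 0) \<and>
      (\<forall>R\<in>S. (\<forall>i\<in>I. covariance M R (Z i) = 0) \<longrightarrow> covariance M R L = 0)"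
  have "\<forall>j\<in>J. \<exists>L. ?pred j L"
  proof
    fix j assume j: "j \<in> J"
    obtain L where "L \<in> S" "L \<in> borel_measurable ?G" "expectation L = expectation (P j)"
      "\<And>i. i \<in> I \<Longrightarrow> covariance M (\<lambda>\<omega>. P j \<omega> - L \<omega>) (Z i) = 0"
      "\<And>R. R \<in> S \<Longrightarrow> \<forall>i\<in>I. covariance M R (Z i) = 0 \<Longrightarrow> covariance M R L = 0"
      by (rule linear_regression[where Z=Z, OF I Z P[OF j]]) (assumption, rule that)
    then show "\<exists>L. ?pred j L" by (intro exI[of _ L]) simp
  qed
  then obtain L where "\<forall>j\<in>J. ?pred j (L j)" by (rule bchoice[THEN exE])
  then have L: "\<And>j. j \<in> J \<Longrightarrow> L j \<in> S" "\<And>j. j \<in> J \<Longrightarrow> L j \<in> borel_measurable ?G"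
    "\<And>j. j \<in> J \<Longrightarrow> expectation (L j) = expectation (P j)"
    "\<And>i j. j \<in> J \<Longrightarrow> i \<in> I \<Longrightarrow> covariance M (\<lambda>\<omega>. P j \<omega> - L j \<omega>) (Z i) = 0"
    "\<And>R j. j \<in> J \<Longrightarrow> R \<in> S \<Longrightarrow> \<forall>i\<in>I. covariance M R (Z i) = 0 \<Longrightarrow> covariance M R (L j) = 0"
    by simp_all
  define Q where "Q \<omega> = (\<Sum>j\<in>J. w j * P j \<omega>)" for \<omega>
  define A where "A \<omega> = (\<Sum>j\<in>J. w j * L j \<omega>)" for \<omega>
  \<comment> \<open>The intercept compensates the means: both \<open>c + Q\<close> and its estimate
    \<open>c + A\<close> from the data have the mean of \<open>X\<close>.\<close>
  define c where "c = expectation X - (\<Sum>j\<in>J. w j * expectation (P j))"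
  define D where "D j \<omega> = P j \<omega> - L j \<omega>" for j \<omega>
  define W where "W \<omega> = (\<Sum>j\<in>J. w j * D j \<omega>)" for \<omega>
  define R where "R \<omega> = X \<omega> - (c + Q \<omega>)" for \<omega>
  define T where "T \<omega> = c + A \<omega>" for \<omega>
  have Q: "Q \<in> S" unfolding Q_def[abs_def] using P by (rule sum)
  have A: "A \<in> S" unfolding A_def[abs_def] using L(1) by (rule sum)
  have D: "D j \<in> S" if "j \<in> J" for j unfolding D_def[abs_def] using that P L(1) by (intro diff)
  have W: "W \<in> S" unfolding W_def[abs_def] using D by (rule sum)
  have cQ: "(\<lambda>\<omega>. c + Q \<omega>) \<in> S" by (intro add const Q)
  have T: "T \<in> S" unfolding T_def[abs_def] by (intro add const A)
  have R: "R \<in> S" unfolding R_def[abs_def] by (intro diff X cQ)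
  have EQ: "expectation (\<lambda>\<omega>. c + Q \<omega>) = expectation X"
  proof -
    have "expectation Q = (\<Sum>j\<in>J. w j * expectation (P j))"
      unfolding Q_def[abs_def] using P by (subst Bochner_Integration.integral_sum) (auto intro: integrable)
    then show ?thesis using integrable[OF Q] by (simp add: c_def prob_space)
  qed
  have ET: "expectation T = expectation X"
  proof -
    have "expectation A = (\<Sum>j\<in>J. w j * expectation (P j))"
      unfolding A_def[abs_def] using L by (subst Bochner_Integration.integral_sum) (auto intro: integrable)
    then show ?thesis using integrable[OF A] by (simp add: c_def prob_space T_def[abs_def])
  qed
  have covR: "covariance M R Y = covariance M (\<lambda>\<omega>. X \<omega> - (\<Sum>j\<in>J. w j * P j \<omega>)) Y" if "Y \<in> S" for Y
    using covariance_diff_left[OF diff[OF X Q] const that, of c] 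
    by (simp add: covariance_const_left R_def[abs_def] Q_def[abs_def] algebra_simps)
  have RP: "covariance M R (P j) = 0" if "j \<in> J" for j using covR[OF P] covP that by simp
  have RZ: "covariance M R (Z i) = 0" if "i \<in> I" for i using covR[OF Z] covZ that by simp
  \<comment> \<open>\<open>R\<close> is uncorrelated with the data, hence also with the projection
    \<open>L j\<close>; this later removes the cross term.\<close>
  have RD: "covariance M R (D j) = 0" if "j \<in> J" for j
    using covariance_diff_right[OF P[OF that] L(1)[OF that] R] RP[OF that] L(5)[OF that R] RZ
    by (simp add: D_def[abs_def])
  have Tm: "T \<in> borel_measurable ?G"
    unfolding T_def[abs_def] A_def[abs_def] using L(2)
    by (intro borel_measurable_add borel_measurable_sum borel_measurable_times) auto
  \<comment> \<open>The error in predicting \<open>X\<close> from the data consists of the error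
    left when all \<open>P j\<close> are known and the weighted errors in predicting the
    \<open>P j\<close>.\<close>
  have XT: "(\<lambda>\<omega>. X \<omega> - T \<omega>) = (\<lambda>\<omega>. R \<omega> + W \<omega>)"
    unfolding R_def T_def Q_def A_def W_def D_def by (auto simp: right_diff_distrib sum_subtractf)
  have XTZ: "covariance M (\<lambda>\<omega>. X \<omega> - T \<omega>) (Z i) = 0" if i: "i \<in> I" for i
    unfolding XT using covariance_add_left[OF R W Z[OF i]] covariance_sum_left[of J D "Z i" w, OF D Z[OF i]] RZ[OF i] L(4) i
    by (simp add: W_def[abs_def] D_def[abs_def])
  have "AE \<omega> in M. real_cond_exp M ?G X \<omega> = T \<omega>"
    by (rule real_cond_exp_eq_regression[where Z=Z, OF I Z X T Tm ET XTZ])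
  moreover have "AE \<omega> in M. \<forall>j\<in>J. real_cond_exp M ?G (P j) \<omega> = L j \<omega>"
    using L J by (intro AE_finite_allI real_cond_exp_eq_regression[where Z=Z, OF I Z P]) auto
  ultimately show ?E
    by eventually_elim (simp add: T_def A_def c_def right_diff_distrib sum_subtractf)
  have "covariance M R W = 0"
    unfolding W_def[abs_def] using covariance_sum_right[of J D R w, OF D R] RD by simp
  then have v1: "covariance M (\<lambda>\<omega>. R \<omega> + W \<omega>) (\<lambda>\<omega>. R \<omega> + W \<omega>) = covariance M R R + covariance M W W"
    using R W add[OF R W] by (simp add: covariance_add_left covariance_add_right covariance_commute)
  have v2: "covariance M W W = (\<Sum>j\<in>J. \<Sum>l\<in>J. w j * w l * covariance M (D j) (D l))"
  proof -
    have "covariance M W W = (\<Sum>j\<in>J. w j * covariance M (D j) W)"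
      using covariance_sum_left[of J D W w, OF D W] by (simp add: W_def[abs_def])
    also have "\<dots> = (\<Sum>j\<in>J. w j * (\<Sum>l\<in>J. w l * covariance M (D j) (D l)))"
      using D by (intro sum.cong refl arg_cong2[where f="(*)"]) (simp add: W_def[abs_def] covariance_sum_right)
    finally show ?thesis by (simp add: sum_distrib_left mult.assoc)
  qed
  have v3: "AE \<omega> in M. cond_var M ?G X \<omega> = covariance M (\<lambda>\<omega>. X \<omega> - T \<omega>) (\<lambda>\<omega>. X \<omega> - T \<omega>)"
    unfolding cond_var_def by (rule cond_cov_eq_covariance[where Z=Z, OF I Z X X T T Tm Tm ET ET XTZ XTZ])
  have v4: "AE \<omega> in M. \<forall>j\<in>J. \<forall>l\<in>J. cond_cov M ?G (P j) (P l) \<omega> = covariance M (D j) (D l)"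
    unfolding D_def[abs_def] using L J
    by (intro AE_finite_allI cond_cov_eq_covariance[where Z=Z, OF I Z P P]) auto
  \<comment> \<open>\<open>R\<close> serves a second time: it is also the residual of
    \<open>X\<close> after regression on the \<open>P j\<close>, so its variance is the conditional
    variance given these.\<close>
  have v5: "AE \<omega> in M. cond_var M (generated_algebra M J P) X \<omega> = covariance M R R"
    unfolding cond_var_def R_def[abs_def]
  proof (rule cond_cov_eq_covariance[where Z=P, OF J P X X cQ cQ _ _ EQ EQ])
    show "(\<lambda>\<omega>. c + Q \<omega>) \<in> borel_measurable (generated_algebra M J P)"
      unfolding Q_def[abs_def] using measurable_generated_algebra[of _ J P M]
      by (intro borel_measurable_add borel_measurable_sum borel_measurable_times) auto
    then show "(\<lambda>\<omega>. c + Q \<omega>) \<in> borel_measurable (generated_algebra M J P)" .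
  qed (use RP in \<open>auto simp: R_def[abs_def]\<close>)
  from v3 v4 v5 show ?V by eventually_elim (simp add: XT v1 v2)
qed

end

section \<open>Gauss-Markov processes\<close>

text \<open>The hypothesis says that the conditional expectation of \<open>W\<close> given
  \<open>X\<close> vanishes, and \<open>X\<close> may be pulled out of it even when unbounded. This
  is the passage from events, in which conditional independence is phrased, to the variables
  themselves.\<close>

lemma integral_mult_eq_0_of_indicators:
  fixes X W :: "'a \<Rightarrow> real"
  assumes "prob_space M" and X[measurable]: "X \<in> borel_measurable M" and W: "integrable M W"
    and XW: "integrable M (\<lambda>\<omega>. X \<omega> * W \<omega>)"
    and orth: "\<And>A. A \<in> sets borel \<Longrightarrow> (\<integral>\<omega>. indicator (X -` A \<inter> space M) \<omega> * W \<omega> \<partial>M) = 0"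
  shows "(\<integral>\<omega>. X \<omega> * W \<omega> \<partial>M) = 0"
proof -
  interpret prob_space M by fact
  let ?G = "vimage_algebra (space M) X borel"
  have sets_G: "sets ?G = {X -` A \<inter> space M | A. A \<in> sets borel}"
    by (rule sets_vimage_algebra2) auto
  have "subalgebra M ?G"
    unfolding subalgebra_def using sets_G by auto
  then interpret G: sigma_finite_subalgebra M ?G by (rule sigma_finite_subalgebraI)
  have XG: "X \<in> borel_measurable ?G" by (rule measurable_vimage_algebra1) auto
  have "AE \<omega> in M. real_cond_exp M ?G W \<omega> = 0"
  proof (rule G.real_cond_exp_charact[where g="\<lambda>_. 0"])
    fix B assume "B \<in> sets ?G"
    then show "(LINT \<omega>:B|M. W \<omega>) = (LINT \<omega>:B|M. 0)"
      using orth unfolding sets_G set_lebesgue_integral_def by auto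
  qed (use W in auto)
  moreover have "(\<integral>\<omega>. X \<omega> * W \<omega> \<partial>M) = (\<integral>\<omega>. X \<omega> * real_cond_exp M ?G W \<omega> \<partial>M)"
    using G.real_cond_exp_intg(2)[OF XW XG] W by simp
  ultimately show ?thesis
    by (subst (asm) integral_cong_AE[where g="\<lambda>_. 0"]) auto
qed

section \<open>The Markov property as a covariance identity\<close>

context gaussian_space
begin

text \<open>With \<open>R\<close> the residual of \<open>X\<close> after regression on
  \<open>Z i\<close>, the claim reduces to orthogonality of \<open>R\<close> and \<open>Y\<close>.
  Conditional independence concerns events, so \<open>Y\<close> is replaced by an indicator
  \<open>?b\<close> and, in the inner argument, \<open>X\<close> by an indicator \<open>?a\<close>.
  The product form keeps the identity meaningful when \<open>Z i\<close> has zero variance.\<close>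

lemma markov_covariance:
  fixes Z :: "'i \<Rightarrow> 'a \<Rightarrow> real"
  assumes X: "X \<in> S" and Z: "Z i \<in> S" and Y: "Y \<in> S"
    and ci: "cond_independent M (generated_algebra M {i} Z) X Y"
  shows "covariance M X Y * covariance M (Z i) (Z i) = covariance M X (Z i) * covariance M (Z i) Y"
proof -
  let ?G = "generated_algebra M {i} Z"
  have ZS: "\<And>k. k \<in> {i} \<Longrightarrow> Z k \<in> S" using Z by simp
  interpret G: sigma_finite_subalgebra M ?G
    by (intro sigma_finite_subalgebraI subalgebra_generated ZS)
  \<comment> \<open>Division by zero makes \<open>\<alpha> = 0\<close> correct when \<open>Z i\<close> is degenerate.\<close>
  define \<alpha> where "\<alpha> = covariance M X (Z i) / covariance M (Z i) (Z i)"
  have \<alpha>: "\<alpha> * covariance M (Z i) (Z i) = covariance M X (Z i)"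
    using covariance_eq_0_degenerate[OF X Z] by (auto simp: \<alpha>_def)
  define L where "L \<omega> = (expectation X - \<alpha> * expectation (Z i)) + \<alpha> * Z i \<omega>" for \<omega>
  have L: "L \<in> S" unfolding L_def[abs_def] by (intro add const scale Z)
  define R where "R \<omega> = X \<omega> - L \<omega>" for \<omega>
  have R: "R \<in> S" unfolding R_def[abs_def] by (intro diff X L)
  have covR: "covariance M R U = covariance M X U - \<alpha> * covariance M (Z i) U" if "U \<in> S" for U
    using covariance_diff_left[OF X L that] covariance_add_left[OF const scale[OF Z] that]
    by (simp add: R_def[abs_def] L_def[abs_def] covariance_const_left covariance_scale_left Z that)
  have EL: "expectation L = expectation X"
    unfolding L_def[abs_def] using integrable[OF Z] by (simp add: prob_space)
  then have ER: "expectation R = 0"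
    unfolding R_def[abs_def] using integrable X L by simp
  have Lm[measurable]: "L \<in> borel_measurable ?G"
    unfolding L_def[abs_def] using measurable_generated_algebra[of i "{i}" Z M] by simp
  have EX: "AE \<omega> in M. real_cond_exp M ?G X \<omega> = L \<omega>"
    by (rule real_cond_exp_eq_regression[OF _ ZS X L Lm EL]) (use covR[OF Z] \<alpha> in \<open>auto simp: R_def[abs_def]\<close>)
  note [measurable] = meas[OF X] meas[OF Y] meas[OF L] meas[OF R]
  have "expectation (\<lambda>\<omega>. Y \<omega> * R \<omega>) = 0"
  proof (rule integral_mult_eq_0_of_indicators[OF prob_space_axioms])
    fix B :: "real set" assume B[measurable]: "B \<in> sets borel"
    let ?b = "indicator (Y -` B \<inter> space M) :: 'a \<Rightarrow> real"
    define q where "q = real_cond_exp M ?G ?b"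
    have qm[measurable]: "q \<in> borel_measurable ?G" "q \<in> borel_measurable M" unfolding q_def by auto
    have bi: "integrable M ?b" by (rule integrable_const_bound[where B=1]) auto
    have "AE \<omega> in M. q \<omega> \<ge> 0" "AE \<omega> in M. q \<omega> \<le> 1"
      unfolding q_def by (auto intro!: G.real_cond_exp_ge_c G.real_cond_exp_le_c bi)
    then have q1: "AE \<omega> in M. \<bar>q \<omega>\<bar> \<le> 1" by eventually_elim auto
    have qi: "integrable M q" by (rule integrable_const_bound[where B=1]) (use q1 in auto)
    have mult: "integrable M (\<lambda>\<omega>. U \<omega> * W \<omega>)"
      if "integrable M U" "W \<in> borel_measurable M" "AE \<omega> in M. \<bar>W \<omega>\<bar> \<le> 1" for U W :: "'a \<Rightarrow> real"
      by (rule Bochner_Integration.integrable_bound[OF that(1)])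
        (use that in \<open>auto simp: abs_mult elim!: eventually_mono intro: mult_left_le\<close>)
    have b1: "AE \<omega> in M. \<bar>?b \<omega>\<bar> \<le> 1" by (auto simp: indicator_def)
    \<comment> \<open>Conditional independence in integrated form: tested against \<open>X\<close>,
      the event of \<open>Y\<close> acts like its conditional probability \<open>q\<close> given
      \<open>Z i\<close>.\<close>
    have 1: "expectation (\<lambda>\<omega>. X \<omega> * (?b \<omega> - q \<omega>)) = 0"
    proof (rule integral_mult_eq_0_of_indicators[OF prob_space_axioms])
      show "integrable M (\<lambda>\<omega>. X \<omega> * (?b \<omega> - q \<omega>))"
        using mult[OF integrable[OF X] _ b1] mult[OF integrable[OF X] _ q1] by (simp add: right_diff_distrib)
      fix A :: "real set" assume A[measurable]: "A \<in> sets borel"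
      let ?a = "indicator (X -` A \<inter> space M) :: 'a \<Rightarrow> real"
      have ai: "integrable M ?a" by (rule integrable_const_bound[where B=1]) auto
      have a1: "AE \<omega> in M. \<bar>?a \<omega>\<bar> \<le> 1" by (auto simp: indicator_def)
      have abi: "integrable M (\<lambda>\<omega>. ?a \<omega> * ?b \<omega>)" by (rule mult[OF ai _ b1]) simp
      have aqi: "integrable M (\<lambda>\<omega>. ?a \<omega> * q \<omega>)" by (rule mult[OF ai _ q1]) simp
      have ab: "indicator ((X -` A \<inter> space M) \<inter> (Y -` B \<inter> space M)) = (\<lambda>\<omega>. ?a \<omega> * ?b \<omega>)"
        by (auto simp: indicator_def)
      \<comment> \<open>Tower property and conditional independence; the
        \<open>?G\<close>-measurable factor \<open>q\<close> is then moved back inside.\<close>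
      have "expectation (\<lambda>\<omega>. ?a \<omega> * ?b \<omega>) = expectation (real_cond_exp M ?G (\<lambda>\<omega>. ?a \<omega> * ?b \<omega>))"
        using G.real_cond_exp_int(2)[OF abi] by simp
      also have "\<dots> = expectation (\<lambda>\<omega>. q \<omega> * real_cond_exp M ?G ?a \<omega>)"
      proof (rule integral_cong_AE)
        have "AE \<omega> in M. cond_prob_given M ?G ((X -` A \<inter> space M) \<inter> (Y -` B \<inter> space M)) \<omega> =
            cond_prob_given M ?G (X -` A \<inter> space M) \<omega> * cond_prob_given M ?G (Y -` B \<inter> space M) \<omega>"
          using ci A B unfolding cond_independent_def by blast
        then show "AE \<omega> in M. real_cond_exp M ?G (\<lambda>\<omega>. ?a \<omega> * ?b \<omega>) \<omega> = q \<omega> * real_cond_exp M ?G ?a \<omega>"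
          unfolding cond_prob_given_def ab q_def by (simp add: mult.commute)
      qed auto
      also have "\<dots> = expectation (\<lambda>\<omega>. q \<omega> * ?a \<omega>)"
        using aqi by (intro G.real_cond_exp_intg(2)) (auto simp: mult.commute)
      finally show "expectation (\<lambda>\<omega>. ?a \<omega> * (?b \<omega> - q \<omega>)) = 0"
        using abi aqi by (simp add: right_diff_distrib mult.commute)
    qed (use bi qi in auto)
    have Xb: "integrable M (\<lambda>\<omega>. X \<omega> * ?b \<omega>)" "integrable M (\<lambda>\<omega>. X \<omega> * q \<omega>)"
      "integrable M (\<lambda>\<omega>. L \<omega> * ?b \<omega>)"
      using mult[OF integrable[OF X] _ b1] mult[OF integrable[OF X] _ q1] mult[OF integrable[OF L] _ b1] by auto
    \<comment> \<open>Once the event is exchanged for \<open>q\<close>, which is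
      \<open>?G\<close>-measurable, \<open>X\<close> may be replaced by its conditional expectation
      \<open>L\<close>; since \<open>L\<close> is \<open>?G\<close>-measurable too, \<open>q\<close>
      may revert to \<open>?b\<close>.\<close>
    have "expectation (\<lambda>\<omega>. X \<omega> * ?b \<omega>) = expectation (\<lambda>\<omega>. q \<omega> * X \<omega>)"
      using 1 Xb by (simp add: right_diff_distrib mult.commute)
    also have "\<dots> = expectation (\<lambda>\<omega>. q \<omega> * real_cond_exp M ?G X \<omega>)"
      using Xb by (intro G.real_cond_exp_intg(2)[symmetric]) (auto simp: mult.commute)
    also have "\<dots> = expectation (\<lambda>\<omega>. L \<omega> * q \<omega>)"
      by (rule integral_cong_AE) (use EX in \<open>auto simp: mult.commute\<close>)
    also have "\<dots> = expectation (\<lambda>\<omega>. L \<omega> * ?b \<omega>)"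
      unfolding q_def using Xb by (intro G.real_cond_exp_intg(2)) auto
    finally show "expectation (\<lambda>\<omega>. ?b \<omega> * R \<omega>) = 0"
      using Xb by (simp add: R_def[abs_def] left_diff_distrib mult.commute[of "indicator _ _"])
  qed (use R Y in \<open>auto intro: integrable integrable_mult\<close>)
  then have "covariance M R Y = 0"
    using covariance_eq[OF R Y] ER by (simp add: mult.commute)
  then have "covariance M X Y = \<alpha> * covariance M (Z i) Y" using covR[OF Y] by simp
  then show ?thesis using \<alpha> by (simp add: mult_ac)
qed

end

section \<open>The Gaussian space spanned by process values and errors\<close>

definition affine_combinations :: "'i set \<Rightarrow> ('i \<Rightarrow> 'a \<Rightarrow> real) \<Rightarrow> ('a \<Rightarrow> real) set" where
  "affine_combinations I Z = {\<lambda>\<omega>. b + (\<Sum>i\<in>I. a i * Z i \<omega>) | a b. True}"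

lemma gaussian_space_affine_combinations:
  assumes "prob_space M" and Z: "jointly_gaussian M I Z"
  shows "gaussian_space M (affine_combinations I Z)"
proof -
  interpret prob_space M by fact
  have comb_meas: "(\<lambda>\<omega>. \<Sum>i\<in>I. a i * Z i \<omega>) \<in> borel_measurable M" for a
    using Z unfolding jointly_gaussian_def by (intro borel_measurable_sum borel_measurable_times) auto
  show ?thesis
  proof
    fix X assume "X \<in> affine_combinations I Z"
    then obtain a b where X: "X = (\<lambda>\<omega>. b + (\<Sum>i\<in>I. a i * Z i \<omega>))"
      unfolding affine_combinations_def by blast
    let ?Y = "\<lambda>\<omega>. \<Sum>i\<in>I. a i * Z i \<omega>"
    have Y[measurable]: "?Y \<in> borel_measurable M" by (rule comb_meas)
    have [measurable]: "X \<in> borel_measurable M" unfolding X by measurable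
    show "X \<in> borel_measurable M" by measurable
    have "gaussian_measure (distr M borel ?Y)"
      using Z unfolding jointly_gaussian_def by blast
    note char_Y = gaussian_measure_distr(3)[OF prob_space_axioms Y this]
    show "gaussian_measure (distr M borel X)"
    proof (rule gaussian_measureI_char)
      show "real_distribution (distr M borel X)" by (rule real_distribution_distr) simp
      show "variance ?Y \<ge> 0" by (rule variance_positive)
      fix t
      have "char (distr M borel X) t = (CLINT \<omega>|M. iexp (t * b) * iexp (t * ?Y \<omega>))"
        unfolding char_def X
        by (subst integral_distr) (auto simp: exp_add distrib_left simp del: of_real_sum)
      also have "\<dots> = iexp (t * b) * char (distr M borel ?Y) t"
        unfolding char_def by (subst integral_distr) (auto simp del: of_real_sum)
      also have "\<dots> = exp (\<i> * t * (b + expectation ?Y) - t\<^sup>2 * variance ?Y / 2)"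
        unfolding char_Y by (simp add: exp_add[symmetric] distrib_left mult.assoc add_diff_eq)
      finally show "char (distr M borel X) t = exp (\<i> * t * (b + expectation ?Y) - t\<^sup>2 * variance ?Y / 2)" .
    qed
    show "(\<lambda>\<omega>. c * X \<omega>) \<in> affine_combinations I Z" for c
      unfolding affine_combinations_def X
      by (intro CollectI exI[of _ "\<lambda>i. c * a i"] exI[of _ "c * b"])
        (simp add: distrib_left sum_distrib_left mult.assoc)
    fix X' assume "X' \<in> affine_combinations I Z"
    then obtain a' b' where X': "X' = (\<lambda>\<omega>. b' + (\<Sum>i\<in>I. a' i * Z i \<omega>))"
      unfolding affine_combinations_def by blast
    show "(\<lambda>\<omega>. X \<omega> + X' \<omega>) \<in> affine_combinations I Z"
      unfolding affine_combinations_def X X'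
      by (intro CollectI exI[of _ "\<lambda>i. a i + a' i"] exI[of _ "b + b'"])
        (simp add: distrib_right sum.distrib add_ac)
  next
    show "(\<lambda>_. c) \<in> affine_combinations I Z" for c
      unfolding affine_combinations_def by (intro CollectI exI[of _ "\<lambda>_. 0"] exI[of _ c]) simp
  qed
qed

lemma mem_affine_combinations:
  assumes "finite I" "i \<in> I"
  shows "Z i \<in> affine_combinations I Z"
  unfolding affine_combinations_def
  by (intro CollectI exI[of _ "\<lambda>j. if j = i then 1 else 0"] exI[of _ 0])
    (use assms in \<open>auto simp: if_distrib[of "\<lambda>c. c * _"] cong: if_cong\<close>)

text \<open>A linear combination over both index sets is a sum of two independent Gaussian
  variables, whose characteristic functions multiply. \<open>F\<close> and \<open>G\<close> may
  exceed the generated sigma-algebras, so that independence of the whole process from the errors can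
  be used for finitely many times.\<close>

lemma jointly_gaussian_indep:
  fixes U :: "'i \<Rightarrow> 'a \<Rightarrow> real" and W :: "'j \<Rightarrow> 'a \<Rightarrow> real"
  assumes "prob_space M" and fin: "finite I" "finite J"
    and U: "jointly_gaussian M I U" and W: "jointly_gaussian M J W"
    and ind: "prob_space.indep_set M (sets F) (sets G)" "space F = space M" "space G = space M"
    and UF: "\<And>i. i \<in> I \<Longrightarrow> U i \<in> borel_measurable F"
    and WG: "\<And>j. j \<in> J \<Longrightarrow> W j \<in> borel_measurable G"
  shows "jointly_gaussian M (I <+> J) (case_sum U W)"
  unfolding jointly_gaussian_def
proof safe
  interpret prob_space M by fact
  fix c :: "'i + 'j \<Rightarrow> real"
  let ?X = "\<lambda>\<omega>. \<Sum>i\<in>I. c (Inl i) * U i \<omega>" and ?Y = "\<lambda>\<omega>. \<Sum>j\<in>J. c (Inr j) * W j \<omega>"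
  have eq: "(\<Sum>k\<in>I <+> J. c k * case_sum U W k \<omega>) = ?X \<omega> + ?Y \<omega>" for \<omega>
    using fin by (simp add: sum.Plus)
  have [measurable]: "?X \<in> borel_measurable M" "?Y \<in> borel_measurable M"
    using U W unfolding jointly_gaussian_def
    by (auto intro!: borel_measurable_sum borel_measurable_times)
  have gX: "gaussian_measure (distr M borel ?X)"
    using U unfolding jointly_gaussian_def by (elim conjE allE[of _ "\<lambda>i. c (Inl i)"])
  have gY: "gaussian_measure (distr M borel ?Y)"
    using W unfolding jointly_gaussian_def by (elim conjE allE[of _ "\<lambda>i. c (Inr i)"])
  have iv: "indep_var borel ?X borel ?Y"
    by (rule indep_set_imp_indep_var[OF ind])
      (auto intro!: borel_measurable_sum borel_measurable_times UF WG)
  show "gaussian_measure (distr M borel (\<lambda>\<omega>. \<Sum>k\<in>I <+> J. c k * case_sum U W k \<omega>))"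
    unfolding eq
  proof (rule gaussian_measureI_char)
    show "variance ?X + variance ?Y \<ge> 0" by (intro add_nonneg_nonneg variance_positive)
    fix t
    show "char (distr M borel (\<lambda>\<omega>. ?X \<omega> + ?Y \<omega>)) t
      = exp (\<i> * t * (expectation ?X + expectation ?Y) - t\<^sup>2 * (variance ?X + variance ?Y) / 2)"
      unfolding char_distr_add[OF iv] gaussian_measure_distr(3)[OF prob_space_axioms _ gX, simplified]
        gaussian_measure_distr(3)[OF prob_space_axioms _ gY, simplified]
      by (simp add: exp_add[symmetric] algebra_simps add_divide_distrib)
  qed (auto intro!: real_distribution_distr)
qed (use U W in \<open>auto simp: jointly_gaussian_def\<close>)

theorem theorem1:
  fixes M :: "'a measure"
    and f :: "real \<Rightarrow> 'a \<Rightarrow> real"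
    and m :: "real \<Rightarrow> real" and C :: "real \<Rightarrow> real \<Rightarrow> real" and V :: "real \<Rightarrow> real"
    and n :: nat
    and xs :: "nat \<Rightarrow> real"
    and \<epsilon> y :: "nat \<Rightarrow> 'a \<Rightarrow> real"
    and D :: "'a measure"
    and x :: real
  assumes "prob_space M"
    and "gauss_markov_process M f"
    and "m = mean_fun M f" and "C = cov_fun M f" and "V = var_fun M f"
    and "n \<ge> 1"
    and "0 \<le> xs 1" and "mono_on {1..n} xs"
    and "jointly_gaussian M {1..n} \<epsilon>"
    and "\<And>i. i \<in> {1..n} \<Longrightarrow> (\<integral>\<omega>. \<epsilon> i \<omega> \<partial>M) = 0"
    and "prob_space.indep_set M (sets (generated_algebra M {0..} f)) (sets (generated_algebra M {1..n} \<epsilon>))"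
    and "y = (\<lambda>i \<omega>. f (xs i) \<omega> + \<epsilon> i \<omega>)"
    and "D = generated_algebra M {1..n} y"
    and "x \<ge> 0"
  shows "cond_gaussian M D (f x) \<and>
    (x \<le> xs 1 \<and> V (xs 1) \<noteq> 0 \<longrightarrow>
      (AE \<omega> in M. real_cond_exp M D (f x) \<omega> =
         m x + C (xs 1) x / V (xs 1) * (real_cond_exp M D (f (xs 1)) \<omega> - m (xs 1))) \<and>
      (AE \<omega> in M. cond_var M D (f x) \<omega> =
         (C (xs 1) x / V (xs 1))\<^sup>2 * cond_var M D (f (xs 1)) \<omega>
         + cond_var M (generated_algebra M {xs 1} f) (f x) \<omega>)) \<and>
    (\<forall>k. 1 \<le> k \<and> k < n \<and> xs k \<le> x \<and> x \<le> xs (k + 1) \<and>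
         V (xs k) * V (xs (k + 1)) - (C (xs k) (xs (k + 1)))\<^sup>2 \<noteq> 0 \<longrightarrow>
      (AE \<omega> in M. real_cond_exp M D (f x) \<omega> =
         m x + weight_vector C V x (xs k) (xs (k + 1)) \<bullet>
           (vector [real_cond_exp M D (f (xs k)) \<omega> - m (xs k),
                    real_cond_exp M D (f (xs (k + 1))) \<omega> - m (xs (k + 1))] :: real ^ 2)) \<and>
      (AE \<omega> in M. cond_var M D (f x) \<omega> =
         weight_vector C V x (xs k) (xs (k + 1)) \<bullet>
           (cond_cov_matrix M D (\<lambda>\<omega>. vector [f (xs k) \<omega>, f (xs (k + 1)) \<omega>] :: real ^ 2) \<omega>
            *v weight_vector C V x (xs k) (xs (k + 1)))
         + cond_var M (generated_algebra M {xs k, xs (k + 1)} f) (f x) \<omega>)) \<and>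
    (x \<ge> xs n \<and> V (xs n) \<noteq> 0 \<longrightarrow>
      (AE \<omega> in M. real_cond_exp M D (f x) \<omega> =
         m x + C (xs n) x / V (xs n) * (real_cond_exp M D (f (xs n)) \<omega> - m (xs n))) \<and>
      (AE \<omega> in M. cond_var M D (f x) \<omega> =
         (C (xs n) x / V (xs n))\<^sup>2 * cond_var M D (f (xs n)) \<omega>
         + cond_var M (generated_algebra M {xs n} f) (f x) \<omega>))"
proof -
  note gm = assms(2)[unfolded gauss_markov_process_def]
  interpret prob_space M by fact
  define I where "I = {1..n}"
  \<comment> \<open>The process is indexed by times, so coinciding sampling points collapse in
    \<open>F\<close>, while the errors keep their indices in \<open>I\<close>.\<close>
  define F where "F = insert x (xs ` I)"
  have xs_mono: "xs i \<le> xs j" if "1 \<le> i" "i \<le> j" "j \<le> n" for i j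
    using mono_onD[OF assms(8)] that by auto
  have xs0: "xs i \<ge> 0" if "i \<in> I" for i
    using xs_mono[of 1 i] assms(7) that by (auto simp: I_def)
  have fin: "finite I" "finite F" unfolding F_def I_def by auto
  have F0: "F \<subseteq> {0..}" using xs0 assms(14) by (auto simp: F_def)
  have xsF: "xs i \<in> F" if "i \<in> I" for i using that by (auto simp: F_def)
  have jf: "jointly_gaussian M F f" using gm fin F0 by blast
  \<comment> \<open>One Gaussian space contains the relevant process values and the errors, hence
    also the observations.\<close>
  define S where "S = affine_combinations (F <+> I) (case_sum f \<epsilon>)"
  have "jointly_gaussian M (F <+> I) (case_sum f \<epsilon>)"
    using F0 fin by (intro jointly_gaussian_indep[OF prob_space_axioms _ _ jf assms(9)[folded I_def] assms(11)])
      (auto intro: measurable_generated_algebra simp: I_def)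
  then interpret S: gaussian_space M S
    unfolding S_def by (rule gaussian_space_affine_combinations[OF prob_space_axioms])
  have fS: "f t \<in> S" if "t \<in> F" for t
    using mem_affine_combinations[OF _ InlI[OF that, of I], of "case_sum f \<epsilon>"] fin by (simp add: S_def)
  have eS: "\<epsilon> i \<in> S" if "i \<in> I" for i
    using mem_affine_combinations[OF _ InrI[OF that, of F], of "case_sum f \<epsilon>"] fin by (simp add: S_def)
  have yS: "y i \<in> S" if "i \<in> I" for i
    unfolding assms(12) using that by (intro S.add fS eS xsF)
  have C: "C s t = covariance M (f s) (f t)" for s t
    unfolding assms(4) cov_fun_def mean_fun_def covariance_def ..
  have V: "V s = covariance M (f s) (f s)" for s
    unfolding assms(5) var_fun_def cov_fun_def mean_fun_def covariance_def ..
  have CC: "C s t = C t s" for s t unfolding C by (rule covariance_commute)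
  have m: "m s = expectation (f s)" for s unfolding assms(3) mean_fun_def ..
  have f\<epsilon>: "covariance M (f t) (\<epsilon> i) = 0" if "t \<in> F" "i \<in> I" for t i
  proof -
    have "indep_var borel (f t) borel (\<epsilon> i)"
      by (rule indep_set_imp_indep_var[OF assms(11)])
        (use that F0 in \<open>auto intro!: measurable_generated_algebra simp: I_def\<close>)
    then show ?thesis
      using S.integrable[OF fS[OF that(1)]] S.integrable[OF eS[OF that(2)]]
      by (subst S.covariance_eq[OF fS[OF that(1)] eS[OF that(2)]])
        (simp add: indep_var_lebesgue_integral)
  qed
  \<comment> \<open>The Markov property covers strictly ordered times only; if \<open>t\<close>
    coincides with an endpoint, the identity is trivial.\<close>
  have markov: "C s u * V t = C s t * C t u" if "s \<in> F" "t \<in> F" "u \<in> F" "s \<le> t" "t \<le> u" for s t u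
  proof (cases "s < t \<and> t < u")
    case True
    then have "cond_independent M (generated_algebra M {t} f) (f s) (f u)"
      using gm F0 that by auto
    then show ?thesis
      unfolding C V by (intro S.markov_covariance fS that)
  next
    case False
    then have "s = t \<or> t = u" using that by auto
    then show ?thesis by (auto simp: C V mult.commute)
  qed
  note D = assms(13)[folded I_def]
  \<comment> \<open>The assumptions are the normal equations for the weights \<open>w\<close>, at
    the predictors' own times and at all sampling times. They carry over to the noisy data, since an
    observation and the process value behind it have the same covariance with every process value at
    a time in \<open>F\<close>.\<close>
  have key: "(AE \<omega> in M. real_cond_exp M D (f x) \<omega>
        = m x + (\<Sum>t\<in>J. w t * (real_cond_exp M D (f t) \<omega> - m t))) \<and>
      (AE \<omega> in M. cond_var M D (f x) \<omega>
        = (\<Sum>s\<in>J. \<Sum>t\<in>J. w s * w t * cond_cov M D (f s) (f t) \<omega>)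
          + cond_var M (generated_algebra M J f) (f x) \<omega>)"
    if J: "J \<subseteq> F" and wJ: "\<And>t. t \<in> J \<Longrightarrow> C x t = (\<Sum>s\<in>J. w s * C s t)"
      and wI: "\<And>i. i \<in> I \<Longrightarrow> C x (xs i) = (\<Sum>s\<in>J. w s * C s (xs i))" for J w
  proof -
    have finJ: "finite J" using J fin finite_subset by blast
    have fJ: "\<And>t. t \<in> J \<Longrightarrow> f t \<in> S" using J fS by auto
    have fx: "f x \<in> S" by (rule fS) (simp add: F_def)
    have cov: "covariance M (\<lambda>\<omega>. f x \<omega> - (\<Sum>s\<in>J. w s * f s \<omega>)) Y
        = covariance M (f x) Y - (\<Sum>s\<in>J. w s * covariance M (f s) Y)" if "Y \<in> S" for Y
      using S.covariance_diff_left[OF fx S.sum[of J f w, OF fJ] that]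
        S.covariance_sum_left[of J f Y w, OF fJ that] by simp
    have 1: "covariance M (\<lambda>\<omega>. f x \<omega> - (\<Sum>s\<in>J. w s * f s \<omega>)) (f t) = 0" if "t \<in> J" for t
      using cov[OF fJ[OF that]] wJ[OF that] by (simp add: C)
    have 2: "covariance M (\<lambda>\<omega>. f x \<omega> - (\<Sum>s\<in>J. w s * f s \<omega>)) (y i) = 0" if i: "i \<in> I" for i
    proof -
      have cy: "covariance M (f s) (y i) = C s (xs i)" if "s \<in> F" for s
        unfolding assms(12) C using S.covariance_add_right[OF fS[OF xsF[OF i]] eS[OF i] fS[OF that]]
        by (simp add: f\<epsilon>[OF that i])
      have "(\<Sum>s\<in>J. w s * covariance M (f s) (y i)) = (\<Sum>s\<in>J. w s * C s (xs i))"
        using J cy by (intro sum.cong) auto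
      then show ?thesis
        using cov[OF yS[OF i]] wI[OF i] cy[of x] by (simp add: F_def)
    qed
    show ?thesis
      using S.cond_exp_cond_var_via_predictors[where Z=y and P=f and w=w, OF fin(1) yS finJ fJ fx 1 2]
      unfolding D m by blast
  qed
  \<comment> \<open>With one predictor the weight is the usual regression coefficient, and the
    normal equation at \<open>t\<close> itself is automatic; those at the sampling times are stated
    in product form to fit \<open>markov\<close>.\<close>
  have single: "(AE \<omega> in M. real_cond_exp M D (f x) \<omega> =
         m x + C t x / V t * (real_cond_exp M D (f t) \<omega> - m t)) \<and>
      (AE \<omega> in M. cond_var M D (f x) \<omega> =
         (C t x / V t)\<^sup>2 * cond_var M D (f t) \<omega> + cond_var M (generated_algebra M {t} f) (f x) \<omega>)"
    if t: "t \<in> F" "V t \<noteq> 0" and cov: "\<And>i. i \<in> I \<Longrightarrow> C x (xs i) * V t = C x t * C t (xs i)" for t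
    using key[of "{t}" "\<lambda>_. C t x / V t"] t cov CC[of t x]
    by (simp add: cond_var_def power2_eq_square field_simps C V)
  have xF: "x \<in> F" by (simp add: F_def)
  show ?thesis
  proof (intro conjI[of "cond_gaussian M D (f x)"] conjI[of "_ \<longrightarrow> _" "_ \<and> _"] conjI[of "All _"] impI allI; (elim conjE)?)
    show "cond_gaussian M D (f x)"
      unfolding D by (rule S.cond_gaussian_generated_algebra[OF fin(1) yS fS[OF xF]])
  next
    assume h: "x \<le> xs 1" "V (xs 1) \<noteq> 0"
    have 1: "1 \<in> I" using assms(6) by (simp add: I_def)
    show "(AE \<omega> in M. real_cond_exp M D (f x) \<omega> =
         m x + C (xs 1) x / V (xs 1) * (real_cond_exp M D (f (xs 1)) \<omega> - m (xs 1))) \<and>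
      (AE \<omega> in M. cond_var M D (f x) \<omega> =
         (C (xs 1) x / V (xs 1))\<^sup>2 * cond_var M D (f (xs 1)) \<omega>
         + cond_var M (generated_algebra M {xs 1} f) (f x) \<omega>)"
    proof (rule single[OF xsF[OF 1] h(2)])
      fix i assume "i \<in> I"
      then show "C x (xs i) * V (xs 1) = C x (xs 1) * C (xs 1) (xs i)"
        using h xs_mono[of 1 i] by (intro markov xF xsF 1) (auto simp: I_def)
    qed
  next
    assume h: "xs n \<le> x" "V (xs n) \<noteq> 0"
    have 1: "n \<in> I" using assms(6) by (simp add: I_def)
    show "(AE \<omega> in M. real_cond_exp M D (f x) \<omega> =
         m x + C (xs n) x / V (xs n) * (real_cond_exp M D (f (xs n)) \<omega> - m (xs n))) \<and>
      (AE \<omega> in M. cond_var M D (f x) \<omega> =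
         (C (xs n) x / V (xs n))\<^sup>2 * cond_var M D (f (xs n)) \<omega>
         + cond_var M (generated_algebra M {xs n} f) (f x) \<omega>)"
    proof (rule single[OF xsF[OF 1] h(2)])
      fix i assume "i \<in> I"
      \<comment> \<open>Here the sampling times lie to the left of \<open>x\<close>, so the identity
        is applied in increasing order of times and read backwards by symmetry.\<close>
      then have "C (xs i) x * V (xs n) = C (xs i) (xs n) * C (xs n) x"
        using h xs_mono[of i n] by (intro markov xF xsF 1) (auto simp: I_def)
      then show "C x (xs i) * V (xs n) = C x (xs n) * C (xs n) (xs i)"
        by (simp add: CC[of x] CC[of "xs n" "xs i"] mult.commute)
    qed
  next
    fix k assume k: "1 \<le> k" "k < n" "xs k \<le> x" "x \<le> xs (k + 1)"
      and det: "V (xs k) * V (xs (k + 1)) - (C (xs k) (xs (k + 1)))\<^sup>2 \<noteq> 0"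
    define a where "a = xs k"
    define b where "b = xs (k + 1)"
    have abF: "a \<in> F" "b \<in> F" using k by (auto simp: a_def b_def I_def intro!: xsF)
    \<comment> \<open>For coinciding times the rows of the covariance matrix would agree and the
      determinant would vanish.\<close>
    have ab: "a \<noteq> b"
      using det unfolding a_def[symmetric] b_def[symmetric] by (auto simp: C V power2_eq_square)
    \<comment> \<open>A vanishing variance would force the covariance, and with it the determinant,
      to vanish. Both variances are cancelled below.\<close>
    have V0: "V a \<noteq> 0" "V b \<noteq> 0"
      using det S.covariance_eq_0_degenerate[OF fS fS, OF abF(2,1)] S.covariance_eq_0_degenerate[OF fS fS, OF abF]
      unfolding a_def[symmetric] b_def[symmetric] by (auto simp: C V covariance_commute)
    define d where "d = V a * V b - (C a b)\<^sup>2"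
    have d: "d \<noteq> 0" using det unfolding d_def a_def b_def .
    define W where "W = weight_vector C V x a b"
    have W: "W $ 1 = (C x a * V b - C x b * C a b) / d" "W $ 2 = (C x b * V a - C x a * C a b) / d"
      unfolding W_def weight_vector_def d_def by simp_all
    \<comment> \<open>\<open>weight_vector\<close> is the solution by Cramer's rule of the two
      normal equations at \<open>a\<close> and \<open>b\<close>; they are verified here and in
      \<open>normal_b\<close>.\<close>
    have normal_a: "C x a = W $ 1 * V a + W $ 2 * C b a"
    proof -
      have "d * (W $ 1 * V a + W $ 2 * C b a) = C x a * d"
        using d unfolding W CC[of b a] by (simp add: field_simps) (simp add: d_def power2_eq_square algebra_simps)
      then show ?thesis using d by (simp add: mult.commute)
    qed
    have normal_b: "C x b = W $ 1 * C a b + W $ 2 * V b"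
    proof -
      have "d * (W $ 1 * C a b + W $ 2 * V b) = C x b * d"
        using d unfolding W by (simp add: field_simps) (simp add: d_def power2_eq_square algebra_simps)
      then show ?thesis using d by (simp add: mult.commute)
    qed
    define w where "w t = (if t = a then W $ 1 else W $ 2)" for t
    have sum_ab: "(\<Sum>t\<in>{a, b}. g t) = g a + g b" for g :: "real \<Rightarrow> real" using ab by simp
    have w: "w a = W $ 1" "w b = W $ 2" using ab by (auto simp: w_def)
    have CV: "C t t = V t" for t by (simp add: C V)
    have "(AE \<omega> in M. real_cond_exp M D (f x) \<omega>
        = m x + (\<Sum>t\<in>{a, b}. w t * (real_cond_exp M D (f t) \<omega> - m t))) \<and>
      (AE \<omega> in M. cond_var M D (f x) \<omega>
        = (\<Sum>s\<in>{a, b}. \<Sum>t\<in>{a, b}. w s * w t * cond_cov M D (f s) (f t) \<omega>)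
          + cond_var M (generated_algebra M {a, b} f) (f x) \<omega>)"
    proof (rule key)
      show "{a, b} \<subseteq> F" using abF by simp
      show "C x t = (\<Sum>s\<in>{a, b}. w s * C s t)" if "t \<in> {a, b}" for t
        using that normal_a normal_b unfolding sum_ab w by (auto simp: CV)
      fix i assume i: "i \<in> I"
      show "C x (xs i) = (\<Sum>s\<in>{a, b}. w s * C s (xs i))"
      \<comment> \<open>Comparing indices rather than times puts every sampling point, including
        repeated ones, on one side of the gap between \<open>a\<close> and \<open>b\<close>.\<close>
      proof (cases "i \<le> k")
        case True
        then have le: "xs i \<le> a" using xs_mono[of i k] i k by (auto simp: a_def I_def)
        have "C (xs i) x * V a = C (xs i) a * C a x"
          by (rule markov) (use le k i abF xF xsF in \<open>auto simp: a_def\<close>)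
        moreover have "C (xs i) b * V a = C (xs i) a * C a b"
          by (rule markov) (use le k i abF xF xsF in \<open>auto simp: a_def b_def\<close>)
        \<comment> \<open>Up to a common factor, the values at \<open>x\<close>, \<open>a\<close>
          and \<open>b\<close> have the same covariances with the value at \<open>xs i\<close> as
          with that at \<open>a\<close>. The normal equation at \<open>xs i\<close> is therefore a
          rescaling of the one at \<open>a\<close>, and \<open>V a\<close> cancels.\<close>
        ultimately have "(C x (xs i) - (W $ 1 * C a (xs i) + W $ 2 * C b (xs i))) * V a
            = C a (xs i) * (C x a - (W $ 1 * V a + W $ 2 * C b a))"
          by (simp add: CC[of "xs i"] CC[of a x] CC[of a b] algebra_simps)
        then show ?thesis using V0 normal_a unfolding sum_ab w by simp
      next
        case False
        then have le: "b \<le> xs i" using xs_mono[of "k + 1" i] i k by (auto simp: b_def I_def)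
        have "C x (xs i) * V b = C x b * C b (xs i)"
          by (rule markov) (use le k i abF xF xsF in \<open>auto simp: b_def\<close>)
        moreover have "C a (xs i) * V b = C a b * C b (xs i)"
          by (rule markov) (use le k i abF xF xsF in \<open>auto simp: a_def b_def\<close>)
        ultimately have "(C x (xs i) - (W $ 1 * C a (xs i) + W $ 2 * C b (xs i))) * V b
            = C b (xs i) * (C x b - (W $ 1 * C a b + W $ 2 * V b))"
          by (simp add: algebra_simps)
        then show ?thesis using V0 normal_b unfolding sum_ab w by simp
      qed
    qed
    then show "(AE \<omega> in M. real_cond_exp M D (f x) \<omega> =
         m x + weight_vector C V x (xs k) (xs (k + 1)) \<bullet>
           (vector [real_cond_exp M D (f (xs k)) \<omega> - m (xs k),
                    real_cond_exp M D (f (xs (k + 1))) \<omega> - m (xs (k + 1))] :: real ^ 2)) \<and>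
      (AE \<omega> in M. cond_var M D (f x) \<omega> =
         weight_vector C V x (xs k) (xs (k + 1)) \<bullet>
           (cond_cov_matrix M D (\<lambda>\<omega>. vector [f (xs k) \<omega>, f (xs (k + 1)) \<omega>] :: real ^ 2) \<omega>
            *v weight_vector C V x (xs k) (xs (k + 1)))
         + cond_var M (generated_algebra M {xs k, xs (k + 1)} f) (f x) \<omega>)"
      unfolding a_def[symmetric] b_def[symmetric] W_def[symmetric] sum_ab w
      by (simp add: inner_vec_def sum_2 cond_cov_matrix_def matrix_vector_mult_def algebra_simps)
  qed
qed

end
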